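(* Let $\log\sigma\in BV([0,1])$ with $\mathrm{Var}(\log\sigma)<\pi$. Let $\lambda_j=-\omega_j^2$, $j=1,2$, be two distinct eigenvalues of $\sigma^{-2}(x)\,d^2/dx^2$ on $[0,1]$ with Dirichlet or Neumann boundary conditions. Then $$\frac{\pi-\mathrm{Var}(\log\sigma)}{\int_0^1\sigma(x)\,dx}\le|\omega_1-\omega_2|\le\frac{\pi+\mathrm{Var}(\log\sigma)}{\int_0^1\sigma(x)\,dx}.$$
   Context: Here $\sigma$ is a function on $[0,1]$ with $0<\sigma_{\min}\le\sigma(x)\le\sigma_{\max}$ for almost every $x$, where $\sigma_{\min},\sigma_{\max}$ are constants. Eigenvalues $\lambda=-\omega^2$ (with $\omega\ge 0$) are those for which $v''+\omega^2\sigma^2v=0$ has a nonzero solution on $[0,1]$ with Dirichlet ($v(0)=v(1)=0$) or Neumann ($v'(0)=v'(1)=0$) boundary conditions; both eigenvalues are taken for the same boundary conditions. $\mathrm{Var}(f)=\sup_{\{x_j\}}\sum_j|f(x_{j-1})-f(x_j)|$, the supremum being over finite partitions of $[0,1]$ such that each $x_j$ is a point of approximate continuity of $f$ (the essential variation, equal to the total variation of $f'$ as a signed measure on $[0,1]$). $BV([0,1])$ is the space of functions $f\in L^1([0,1])$ with $\mathrm{Var}(f)<\infty$, with norm $\|f\|_{L^1}+\mathrm{Var}(f)$.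
   Formalization: The upper bound is proved only for neighbouring distinct eigenvalues (none strictly between, same boundary condition); as printed it fails for σ=1, Dirichlet, ω=π and 3π. The lower bound holds for all distinct pairs. *)

theory Defs
  imports "HOL-Analysis.Analysis"
begin

text \<open>Functions on \<open>[0,1]\<close> are represented by total functions on the reals; none of the notions
  below depends on values outside \<open>{0..1}\<close>.\<close>

text \<open>Density is taken relative to \<open>[0,1]\<close>, so at the end points
  approximate continuity is one-sided.\<close>

definition approx_continuous01 :: "(real \<Rightarrow> real) \<Rightarrow> real \<Rightarrow> bool" where
  "approx_continuous01 f x \<longleftrightarrow>
     (\<forall>\<epsilon>>0. ((\<lambda>r. measure lebesgue {y \<in> {0..1} \<inter> ball x r. \<bar>f y - f x\<bar> \<ge> \<epsilon>}
                   / measure lebesgue ({0..1} \<inter> ball x r)) \<longlongrightarrow> 0) (at_right 0))"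

text \<open>The points \<open>0\<close> and \<open>1\<close> are not required to be partition points, since \<open>f\<close> need not
  be approximately continuous there.\<close>

definition partition01 :: "(real \<Rightarrow> real) \<Rightarrow> nat \<Rightarrow> (nat \<Rightarrow> real) \<Rightarrow> bool" where
  "partition01 f n t \<longleftrightarrow>
     (\<forall>i\<le>n. t i \<in> {0..1} \<and> approx_continuous01 f (t i)) \<and> (\<forall>i<n. t i < t (Suc i))"

definition ess_variation :: "(real \<Rightarrow> real) \<Rightarrow> ennreal" where
  "ess_variation f =
     (SUP (n, t) \<in> {(n, t). partition01 f n t}. ennreal (\<Sum>i<n. \<bar>f (t i) - f (t (Suc i))\<bar>))"

definition BV01 :: "(real \<Rightarrow> real) set" where
  "BV01 = {f. integrable (lebesgue_on {0..1}) f \<and> ess_variation f < \<infinity>}"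

text \<open>\<open>f\<close> is absolutely continuous on \<open>[0,1]\<close> (equivalently, the continuous representative of a
  \<open>W\<^sup>1\<^sup>,\<^sup>1\<close> function) with derivative \<open>g\<close>.\<close>

definition has_weak_deriv01 :: "(real \<Rightarrow> real) \<Rightarrow> (real \<Rightarrow> real) \<Rightarrow> bool" where
  "has_weak_deriv01 f g \<longleftrightarrow>
     integrable (lebesgue_on {0..1}) g \<and>
     (\<forall>x\<in>{0..1}. f x - f 0 = (LINT s|lebesgue_on {0..x}. g s))"

datatype boundary_condition = Dirichlet | Neumann

text \<open>The second argument stands for the derivative \<open>v'\<close> of \<open>v\<close>.\<close>

fun satisfies_bc :: "boundary_condition \<Rightarrow> (real \<Rightarrow> real) \<Rightarrow> (real \<Rightarrow> real) \<Rightarrow> bool" where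
  "satisfies_bc Dirichlet v v' \<longleftrightarrow> v 0 = 0 \<and> v 1 = 0"
| "satisfies_bc Neumann v v' \<longleftrightarrow> v' 0 = 0 \<and> v' 1 = 0"

text \<open>Since \<open>\<sigma>\<close> is only determined almost everywhere and may jump, \<open>v'' + \<omega>\<^sup>2 \<sigma>\<^sup>2 v = 0\<close> holds
  almost everywhere, for \<open>v\<close> continuously differentiable with \<open>v'\<close> absolutely continuous.\<close>

definition solution01 ::
  "(real \<Rightarrow> real) \<Rightarrow> real \<Rightarrow> (real \<Rightarrow> real) \<Rightarrow> (real \<Rightarrow> real) \<Rightarrow> bool" where
  "solution01 \<sigma> \<omega> v v' \<longleftrightarrow>
     (\<forall>x\<in>{0..1}. (v has_real_derivative v' x) (at x within {0..1})) \<and>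
     (\<exists>v''. has_weak_deriv01 v' v'' \<and>
        (AE x in lebesgue_on {0..1}. v'' x + \<omega>\<^sup>2 * (\<sigma> x)\<^sup>2 * v x = 0))"

definition eigenvalue :: "boundary_condition \<Rightarrow> (real \<Rightarrow> real) \<Rightarrow> real \<Rightarrow> bool" where
  "eigenvalue bc \<sigma> lam \<longleftrightarrow>
     (\<exists>\<omega>\<ge>0. lam = - (\<omega>\<^sup>2) \<and>
        (\<exists>v v'. solution01 \<sigma> \<omega> v v' \<and> satisfies_bc bc v v' \<and> (\<exists>x\<in>{0..1}. v x \<noteq> 0)))"

end

theory Submission
  imports Defs
begin

text \<open>
  Away from \<open>\<omega> = 0\<close> the idea is the Pruefer angle adapted to the coefficient: put
  \<open>v' = r cos \<theta>\<close> and \<open>\<omega> \<sigma> v = r sin \<theta>\<close>. For smooth \<open>\<sigma>\<close> this gives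
  \<open>\<theta>' = \<omega> \<sigma> + (ln \<sigma>)' sin \<theta> cos \<theta>\<close>, and since \<open>\<bar>sin \<theta> cos \<theta>\<bar> \<le> 1/2\<close>, the angle advances over
  \<open>[0,1]\<close> by \<open>\<omega> \<integral>\<sigma>\<close> up to an error of at most \<open>Var (ln \<sigma>) / 2\<close>. The boundary conditions force the
  total advance at an eigenvalue to be \<open>k \<pi>\<close> for an integer \<open>k\<close>, hence
  \<open>\<bar>k \<pi> - \<omega> \<integral>\<sigma>\<bar> \<le> Var (ln \<sigma>) / 2\<close> (\<open>eigenphase\<close>). Subtracting this for two eigenvalues yields both
  bounds, provided that distinct eigenvalues have distinct \<open>k\<close> (\<open>eigenphase_strict_mono\<close>) and that
  a jump of \<open>k\<close> by two or more leaves room for another eigenvalue (\<open>eigenvalue_between\<close>).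

  For \<open>\<sigma>\<close> with \<open>ln \<sigma>\<close> merely of bounded essential variation, the differential equation of \<open>\<theta>\<close> is
  replaced by a step-by-step argument. On a short interval the solution is compared with the
  rotation at constant speed \<open>\<omega> c\<close>, where \<open>c\<close> is the value of \<open>\<sigma>\<close> at a point \<open>t\<close> of that interval; the
  error is controlled by \<open>\<integral>\<bar>\<sigma> - c\<bar>\<close> (\<open>angle_flow\<close>). Passing from \<open>c\<close> to the next value \<open>c'\<close> changes the
  angle by at most \<open>\<bar>ln c - ln c'\<bar> / 2\<close> (\<open>angle_jump\<close>). If all sample points are points of approximate
  continuity, the jumps add up to at most half of the essential variation. By the Lebesgue density
  theorem almost every point qualifies (\<open>AE_approx_continuous01\<close>), so the samples can moreover be
  chosen such that the sum of the errors \<open>\<integral>\<bar>\<sigma> - c\<bar>\<close> is arbitrarily small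
  (\<open>step_function_approximation\<close>). Only the direction of \<open>(v', \<omega> c v)\<close> at the grid points is tracked.

  Solutions depending on \<open>\<mu> = \<omega>\<^sup>2\<close> are obtained by shooting from the left boundary condition, as power
  series in \<open>\<mu>\<close>. Eigenvalues are the zeros of the defect in the right boundary condition, a continuous
  function of \<open>\<mu>\<close>. By the Lagrange identity the defect crosses every zero with a direction given by
  the parity of \<open>k\<close>. Since \<open>Var (ln \<sigma>) < \<pi>\<close> makes \<open>k\<close> a monotone function of \<open>\<omega>\<close> along the zeros, two zeros
  with the same \<open>k\<close> would enclose only crossings in the same direction, which is impossible for a
  continuous function; this is the strict monotonicity. Existence of an eigenvalue between \<open>k\<close> and
  \<open>k + 2\<close> is the intermediate value theorem, applied where \<open>\<omega> \<integral>\<sigma>\<close> equals \<open>(k + 1/2) \<pi>\<close> and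
  \<open>(k + 3/2) \<pi>\<close>: there the phase estimate determines the sign of the defect.
\<close>

section \<open>Density points and approximate continuity\<close>

text \<open>Take an open \<open>T \<supseteq> A\<close> with \<open>T - A\<close> of measure less than \<open>c * e\<close>. By Vitali, disjoint balls inside \<open>T\<close>
  in which the complement of \<open>A\<close> has proportion more than \<open>c\<close> cover the exceptional points up to a
  null set. Their total measure is below \<open>e\<close>, because a fraction \<open>c\<close> of each lies in \<open>T - A\<close>.\<close>

lemma negligible_upper_density_complement:
  fixes A :: "'a::euclidean_space set"
  assumes A: "A \<in> sets lebesgue" and c: "0 < c"
  shows "negligible {x \<in> A. \<exists>\<^sub>F r in at_right 0.
           c * measure lebesgue (ball x r) < measure lebesgue (ball x r - A)}" (is "negligible ?S")
proof (subst negligible_outer_le, intro allI impI)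
  fix e :: real assume "e > 0"
  with c have "c * e > 0" by simp
  from sets_lebesgue_outer_open[OF A this] obtain T where
    T: "open T" "A \<subseteq> T" "T - A \<in> lmeasurable" "emeasure lebesgue (T - A) < ennreal (c * e)"
    by blast
  define K where "K = {(x, r). x \<in> ?S \<and> 0 < r \<and> ball x r \<subseteq> T \<and>
      c * measure lebesgue (ball x r) < measure lebesgue (ball x r - A)}"
  have small: "\<exists>i\<in>K. x \<in> ball (fst i) (snd i) \<and> snd i < d" if x: "x \<in> ?S" and d: "0 < d" for x d
  proof -
    from x T(2) have "x \<in> T" by auto
    with T(1) obtain d' where d': "d' > 0" "ball x d' \<subseteq> T" by (meson open_contains_ball)
    have "\<forall>\<^sub>F r in at_right 0. 0 < r \<and> r < min d d'"
      using d d' by (intro eventually_conj eventually_at_right_less eventually_at_rightI[of 0 "min d d'"]) auto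
    with x have "\<exists>\<^sub>F r in at_right 0. c * measure lebesgue (ball x r) < measure lebesgue (ball x r - A) \<and>
       0 < r \<and> r < min d d'"
      using frequently_rev_mp[of _ "at_right 0"] by (auto elim!: frequently_rev_mp eventually_mono)
    then obtain r where r: "c * measure lebesgue (ball x r) < measure lebesgue (ball x r - A)"
       "0 < r" "r < min d d'" by (auto dest: frequently_ex)
    then have "(x, r) \<in> K" using x d' by (auto simp: K_def)
    with r show ?thesis by force
  qed
  obtain C where C: "countable C" "C \<subseteq> K"
     and dis: "pairwise (\<lambda>i j. disjnt (ball (fst i) (snd i)) (ball (fst j) (snd j))) C"
     and neg: "negligible (?S - (\<Union>i\<in>C. ball (fst i) (snd i)))"
  proof (rule Vitali_covering_theorem_balls[of ?S K fst snd])
    show "\<exists>i. i \<in> K \<and> x \<in> ball (fst i) (snd i) \<and> snd i < d" if "x \<in> ?S" "0 < d" for x d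
      using small[OF that] by (auto simp only: Bex_def)
  qed
  define U where "U = (\<Union>i\<in>C. ball (fst i) (snd i))"
  have U: "U \<in> sets lebesgue" unfolding U_def using C(1) by (intro sets.countable_UN'') auto
  have dis': "disjoint_family_on (\<lambda>i. ball (fst i) (snd i)) C"
    using dis by (auto simp: disjoint_family_on_def pairwise_def disjnt_def)
  have "ennreal c * emeasure lebesgue U
      = (\<integral>\<^sup>+i. ennreal c * emeasure lebesgue (ball (fst i) (snd i)) \<partial>count_space C)"
    unfolding U_def using C(1) dis'
    by (subst emeasure_UN_countable) (auto simp: nn_integral_cmult)
  also have "\<dots> \<le> (\<integral>\<^sup>+i. emeasure lebesgue (ball (fst i) (snd i) - A) \<partial>count_space C)"
  proof (rule nn_integral_mono)
    fix i assume "i \<in> space (count_space C)"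
    with C(2) have "i \<in> K" by auto
    have fin: "ball (fst i) (snd i) - A \<in> lmeasurable"
      using A by (intro fmeasurable_Diff) auto
    have "c * measure lebesgue (ball (fst i) (snd i)) \<le> measure lebesgue (ball (fst i) (snd i) - A)"
      using \<open>i \<in> K\<close> by (auto simp: K_def)
    then have "ennreal c * ennreal (measure lebesgue (ball (fst i) (snd i)))
        \<le> ennreal (measure lebesgue (ball (fst i) (snd i) - A))"
      using c by (simp only: ennreal_mult'[symmetric] less_imp_le ennreal_leI)
    then show "ennreal c * emeasure lebesgue (ball (fst i) (snd i)) \<le> emeasure lebesgue (ball (fst i) (snd i) - A)"
      by (simp only: emeasure_eq_measure2[OF fin] emeasure_eq_measure2[OF lmeasurable_ball])
  qed
  also have "\<dots> = emeasure lebesgue (\<Union>i\<in>C. ball (fst i) (snd i) - A)"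
  proof (rule emeasure_UN_countable[symmetric])
    show "disjoint_family_on (\<lambda>i. ball (fst i) (snd i) - A) C"
      using dis' unfolding disjoint_family_on_def by blast
  qed (use C(1) A in auto)
  also have "\<dots> \<le> emeasure lebesgue (T - A)"
  proof (rule emeasure_mono)
    show "(\<Union>i\<in>C. ball (fst i) (snd i) - A) \<subseteq> T - A"
      using C(2) unfolding K_def by fastforce
  qed (use T(3) in auto)
  also have "\<dots> \<le> ennreal (c * e)" using T(4) by simp
  also have "\<dots> = ennreal c * ennreal e" using c by (simp add: ennreal_mult')
  finally have le: "emeasure lebesgue U \<le> ennreal e"
    using c by (simp add: ennreal_mult_le_mult_iff)
  then have Ul: "U \<in> lmeasurable" using U le_less_trans[OF le ennreal_less_top] by (intro fmeasurableI) auto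
  have meas: "measure lebesgue U \<le> e"
    using le \<open>e > 0\<close> by (simp only: emeasure_eq_measure2[OF Ul] ennreal_le_iff less_imp_le)
  have nN: "?S - U \<in> null_sets lebesgue"
    using neg by (simp only: U_def negligible_iff_null_sets)
  have "U \<union> (?S - U) \<in> lmeasurable"
    using Ul negligible_imp_measurable[OF neg] unfolding U_def by (rule fmeasurable.Un)
  moreover have "measure lebesgue (U \<union> (?S - U)) = measure lebesgue U"
    using U nN by (rule measure_Un_null_set)
  ultimately show "\<exists>T. ?S \<subseteq> T \<and> T \<in> lmeasurable \<and> measure lebesgue T \<le> e"
    using meas by (intro exI[of _ "U \<union> (?S - U)"]) (simp only: Un_Diff_cancel Un_upper2 simp_thms)
qed

lemma lebesgue_density:
  fixes A :: "'a::euclidean_space set"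
  assumes A: "A \<in> sets lebesgue"
  shows "negligible {x \<in> A. \<not> ((\<lambda>r. measure lebesgue (ball x r - A) / measure lebesgue (ball x r)) \<longlongrightarrow> 0) (at_right 0)}"
    (is "negligible ?N")
proof -
  let ?S = "\<lambda>n::nat. {x \<in> A. \<exists>\<^sub>F r in at_right 0.
           inverse (Suc n) * measure lebesgue (ball x r) < measure lebesgue (ball x r - A)}"
  have "?N \<subseteq> (\<Union>n. ?S n)"
  proof
    fix x assume x: "x \<in> ?N"
    let ?f = "\<lambda>r. measure lebesgue (ball x r - A) / measure lebesgue (ball x r)"
    from x obtain e where "e > 0" and e: "\<exists>\<^sub>F r in at_right 0. \<not> dist (?f r) 0 < e"
      by (auto simp: tendsto_iff not_eventually)
    obtain n where n: "inverse (real (Suc n)) < e" using reals_Archimedean \<open>e > 0\<close> by blast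
    have "\<exists>\<^sub>F r in at_right 0. inverse (Suc n) * measure lebesgue (ball x r) < measure lebesgue (ball x r - A)"
    proof (rule frequently_rev_mp[OF e], rule eventually_at_rightI[of 0 1])
      fix r :: real assume r: "r \<in> {0<..<1}"
      then have p: "measure lebesgue (ball x r) > 0" by (simp add: content_ball_pos)
      show "\<not> dist (?f r) 0 < e \<longrightarrow>
        inverse (Suc n) * measure lebesgue (ball x r) < measure lebesgue (ball x r - A)"
      proof
        assume "\<not> dist (?f r) 0 < e"
        then have "e \<le> ?f r" by (simp add: not_less)
        with n have "inverse (real (Suc n)) < ?f r" by linarith
        with p show "inverse (Suc n) * measure lebesgue (ball x r) < measure lebesgue (ball x r - A)"
          by (simp only: pos_less_divide_eq)
      qed
    qed simp
    with x show "x \<in> (\<Union>n. ?S n)" by auto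
  qed
  moreover have "negligible (\<Union>n. ?S n)"
    using negligible_upper_density_complement[OF A] by (intro negligible_Union_nat allI) (simp del: of_nat_Suc)
  ultimately show ?thesis by (rule negligible_subset[rotated])
qed

text \<open>A point is a point of approximate continuity as soon as it is a density point of every set
  \<open>{y. \<bar>f y - q\<bar> < 1/(n+1)}\<close> (\<open>q\<close> rational) that contains it, and there are only countably many
  such sets.\<close>

lemma AE_approx_continuous01:
  fixes f :: "real \<Rightarrow> real"
  assumes f: "f \<in> borel_measurable (lebesgue_on {0..1})"
  shows "negligible {x \<in> {0..1}. \<not> approx_continuous01 f x}"
proof -
  let ?\<mu> = "measure lebesgue"
  define A where "A = (\<lambda>(q::rat) (n::nat). {y \<in> {0..1}. \<bar>f y - of_rat q\<bar> < inverse (real (Suc n))})"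
  define N where "N = (\<lambda>q n. {x \<in> A q n. \<not> ((\<lambda>r. ?\<mu> (ball x r - A q n) / ?\<mu> (ball x r)) \<longlongrightarrow> 0) (at_right 0)})"
  have A: "A q n \<in> sets lebesgue" for q n
  proof -
    have "{y \<in> space (lebesgue_on {0..1}). \<bar>f y - of_rat q\<bar> < inverse (real (Suc n))} \<in> sets (lebesgue_on {0..1})"
      using f by measurable
    then show ?thesis by (simp add: A_def space_restrict_space sets_restrict_space_iff del: of_nat_Suc)
  qed
  have "negligible (\<Union>(q, n) \<in> UNIV. N q n)"
    using lebesgue_density[OF A]
    by (intro negligible_countable_Union countable_image) (auto simp: N_def simp del: measure_completion measure_lborel_cbox)
  moreover have "{x \<in> {0..1}. \<not> approx_continuous01 f x} \<subseteq> (\<Union>(q, n) \<in> UNIV. N q n)"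
  proof (rule subsetI, rule ccontr)
    fix x assume x: "x \<in> {x \<in> {0..1}. \<not> approx_continuous01 f x}" and nN: "x \<notin> (\<Union>(q, n) \<in> UNIV. N q n)"
    have "approx_continuous01 f x" unfolding approx_continuous01_def
    proof (intro allI impI)
      fix e :: real assume "e > 0"
      then obtain n where n: "inverse (real (Suc n)) < e / 2"
        using reals_Archimedean[of "e / 2"] by auto
      obtain q where "f x < of_rat q" "of_rat q < f x + inverse (real (Suc n))"
        using of_rat_dense[of "f x" "f x + inverse (real (Suc n))"] by auto
      then have xA: "x \<in> A q n" using x by (auto simp: A_def)
      with nN have lim: "((\<lambda>r. ?\<mu> (ball x r - A q n) / ?\<mu> (ball x r)) \<longlongrightarrow> 0) (at_right 0)"
        by (auto simp: N_def)
      show "((\<lambda>r. ?\<mu> {y \<in> {0..1} \<inter> ball x r. e \<le> \<bar>f y - f x\<bar>} / ?\<mu> ({0..1} \<inter> ball x r)) \<longlongrightarrow> 0) (at_right 0)"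
      proof (rule Lim_null_comparison)
        show "((\<lambda>r. 2 * (?\<mu> (ball x r - A q n) / ?\<mu> (ball x r))) \<longlongrightarrow> 0) (at_right 0)"
          using tendsto_mult_left[OF lim, of 2] by simp
        show "\<forall>\<^sub>F r in at_right 0. norm (?\<mu> {y \<in> {0..1} \<inter> ball x r. e \<le> \<bar>f y - f x\<bar>} / ?\<mu> ({0..1} \<inter> ball x r))
            \<le> 2 * (?\<mu> (ball x r - A q n) / ?\<mu> (ball x r))"
        proof (rule eventually_at_rightI[of 0 "1/2"])
          fix r :: real assume r: "r \<in> {0<..<1/2}"
          define E where "E = {y \<in> {0..1} \<inter> ball x r. e \<le> \<bar>f y - f x\<bar>}"
          have ball: "?\<mu> (ball x r) = 2 * r" using r by (simp add: ball_eq_greaterThanLessThan)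
          have "E \<subseteq> ball x r - A q n"
          proof
            fix y assume y: "y \<in> E"
            moreover have "y \<notin> A q n"
            proof
              assume "y \<in> A q n"
              then have "\<bar>f y - of_rat q\<bar> < e / 2" using n by (simp add: A_def del: of_nat_Suc)
              moreover have "\<bar>f x - of_rat q\<bar> < e / 2" using xA n by (simp add: A_def del: of_nat_Suc)
              moreover have "e \<le> \<bar>f y - f x\<bar>" using y by (simp add: E_def)
              ultimately show False by linarith
            qed
            ultimately show "y \<in> ball x r - A q n" by (auto simp: E_def)
          qed
          moreover have "ball x r - A q n \<in> lmeasurable" using A by (intro fmeasurable_Diff) auto
          moreover have "E \<in> sets lebesgue"
          proof -
            have "{y \<in> space (lebesgue_on {0..1}). e \<le> \<bar>f y - f x\<bar>} \<in> sets (lebesgue_on {0..1})"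
              using f by measurable
            then have "{y \<in> {0..1}. e \<le> \<bar>f y - f x\<bar>} \<in> sets lebesgue"
              by (simp add: space_restrict_space sets_restrict_space_iff)
            then have "{y \<in> {0..1}. e \<le> \<bar>f y - f x\<bar>} \<inter> ball x r \<in> sets lebesgue"
              by (intro sets.Int) auto
            moreover have "E = {y \<in> {0..1}. e \<le> \<bar>f y - f x\<bar>} \<inter> ball x r"
              by (auto simp: E_def)
            ultimately show ?thesis by simp
          qed
          ultimately have 1: "?\<mu> E \<le> ?\<mu> (ball x r - A q n)"
            by (intro measure_mono_fmeasurable)
          \<comment> \<open>Half of the ball lies in the unit interval, whichever end the centre is close to.\<close>
          have 2: "r \<le> ?\<mu> ({0..1} \<inter> ball x r)"
          proof -
            define a where "a = (if x \<le> 1/2 then x else x - r)"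
            have "{a<..<a+r} \<subseteq> {0..1} \<inter> ball x r"
              using x r by (auto simp: a_def dist_real_def split: if_splits)
            then have "?\<mu> {a<..<a+r} \<le> ?\<mu> ({0..1} \<inter> ball x r)"
              by (intro measure_mono_fmeasurable) auto
            then show ?thesis using r by simp
          qed
          have "?\<mu> E / ?\<mu> ({0..1} \<inter> ball x r) \<le> ?\<mu> (ball x r - A q n) / r"
            using 1 2 r by (intro frac_le) auto
          then show "norm (?\<mu> {y \<in> {0..1} \<inter> ball x r. e \<le> \<bar>f y - f x\<bar>} / ?\<mu> ({0..1} \<inter> ball x r))
            \<le> 2 * (?\<mu> (ball x r - A q n) / ?\<mu> (ball x r))"
            unfolding E_def[symmetric] ball using r by (simp add: field_simps)
        qed simp
      qed
    qed
    with x show False by simp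
  qed
  ultimately show ?thesis by (rule negligible_subset)
qed

section \<open>Bounded measurable functions on the unit interval\<close>

lemma AE_lebesgue_on_negligible:
  assumes "AE x in lebesgue_on S. P x" "S \<in> sets lebesgue"
  shows "negligible {x \<in> S. \<not> P x}"
proof -
  have "AE x in lebesgue. x \<in> S \<longrightarrow> P x"
    using assms by (simp add: AE_restrict_space_iff)
  then obtain N where "N \<in> null_sets lebesgue" "{x. \<not> (x \<in> S \<longrightarrow> P x)} \<subseteq> N"
    by (auto simp: eventually_ae_filter)
  then show ?thesis by (auto simp: negligible_iff_null_sets[symmetric] intro: negligible_subset)
qed

lemma negligible_AE_lebesgue_on:
  assumes "negligible N" "S \<in> sets lebesgue" "\<And>x. x \<in> S - N \<Longrightarrow> P x"
  shows "AE x in lebesgue_on S. P x"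
proof -
  have "AE x in lebesgue. x \<notin> N" using assms(1) by (auto simp: negligible_iff_null_sets intro: AE_not_in)
  then have "AE x in lebesgue. x \<in> S \<longrightarrow> P x" by eventually_elim (use assms(3) in auto)
  then show ?thesis using assms(2) by (simp add: AE_restrict_space_iff)
qed

text \<open>The class of integrands used throughout: it is closed under algebraic operations, and its members
  are integrable on every subinterval.\<close>

definition bdd_meas01 :: "(real \<Rightarrow> real) \<Rightarrow> bool" where
  "bdd_meas01 f \<longleftrightarrow> f \<in> borel_measurable (lebesgue_on {0..1}) \<and> bounded (f ` {0..1})"

lemma bdd_meas01_bound:
  assumes "bdd_meas01 f"
  obtains B where "B > 0" "\<And>x. x \<in> {0..1} \<Longrightarrow> \<bar>f x\<bar> \<le> B"
  using assms unfolding bdd_meas01_def bounded_pos by auto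

lemma bdd_meas01I:
  assumes "f \<in> borel_measurable (lebesgue_on {0..1})" "\<And>x. x \<in> {0..1} \<Longrightarrow> \<bar>f x\<bar> \<le> B"
  shows "bdd_meas01 f"
  unfolding bdd_meas01_def bounded_iff using assms by (auto intro!: exI[of _ B])

lemma bdd_meas01_const: "bdd_meas01 (\<lambda>x. c)"
  by (rule bdd_meas01I[of _ "\<bar>c\<bar>"]) auto

lemma bdd_meas01_continuous: "continuous_on {0..1} f \<Longrightarrow> bdd_meas01 f"
  unfolding bdd_meas01_def
  by (auto intro!: continuous_imp_measurable_on_sets_lebesgue compact_imp_bounded compact_continuous_image)

lemma bdd_meas01_comp2:
  assumes "bdd_meas01 f" "bdd_meas01 g"
  shows bdd_meas01_add: "bdd_meas01 (\<lambda>x. f x + g x)"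
    and bdd_meas01_diff: "bdd_meas01 (\<lambda>x. f x - g x)"
    and bdd_meas01_mult: "bdd_meas01 (\<lambda>x. f x * g x)"
proof -
  obtain B where B: "B > 0" "\<And>x. x \<in> {0..1} \<Longrightarrow> \<bar>f x\<bar> \<le> B" using bdd_meas01_bound[OF assms(1)] by blast
  obtain C where C: "C > 0" "\<And>x. x \<in> {0..1} \<Longrightarrow> \<bar>g x\<bar> \<le> C" using bdd_meas01_bound[OF assms(2)] by blast
  have m: "f \<in> borel_measurable (lebesgue_on {0..1})" "g \<in> borel_measurable (lebesgue_on {0..1})"
    using assms by (auto simp: bdd_meas01_def)
  have "\<bar>f x + g x\<bar> \<le> B + C \<and> \<bar>f x - g x\<bar> \<le> B + C \<and> \<bar>f x * g x\<bar> \<le> B * C" if "x \<in> {0..1}" for x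
    using B(2)[OF that] C(2)[OF that] mult_mono[OF B(2)[OF that] C(2)[OF that]] B(1) by (auto simp: abs_mult)
  with m show "bdd_meas01 (\<lambda>x. f x + g x)" "bdd_meas01 (\<lambda>x. f x - g x)" "bdd_meas01 (\<lambda>x. f x * g x)"
    by - (rule bdd_meas01I[of _ "B + C"] bdd_meas01I[of _ "B * C"]; simp)+
qed

lemma bdd_meas01_minus: "bdd_meas01 f \<Longrightarrow> bdd_meas01 (\<lambda>x. - f x)"
  using bdd_meas01_diff[OF bdd_meas01_const, of f 0] by simp

lemma bdd_meas01_abs: "bdd_meas01 f \<Longrightarrow> bdd_meas01 (\<lambda>x. \<bar>f x\<bar>)"
  by (auto simp: bdd_meas01_def bounded_iff)

lemmas bdd_meas01_intros = bdd_meas01_const bdd_meas01_add bdd_meas01_diff bdd_meas01_mult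
  bdd_meas01_minus bdd_meas01_abs

lemma bdd_meas01_absolutely_integrable:
  assumes "bdd_meas01 f"
  shows "f absolutely_integrable_on {0..1}"
  using absolutely_integrable_bounded_measurable_product_real[of f "{0..1}" "\<lambda>x. 1"] assms
  by (auto simp: bdd_meas01_def absolutely_integrable_on_const)

lemma bdd_meas01_integrable_on:
  assumes "bdd_meas01 f" "0 \<le> a" "b \<le> 1"
  shows "f integrable_on {a..b}"
proof -
  have "f integrable_on {0..1}"
    using bdd_meas01_absolutely_integrable[OF assms(1)] by (rule set_lebesgue_integral_eq_integral(1))
  then show ?thesis by (rule integrable_on_subinterval) (use assms in auto)
qed

lemma integral_diff_eq_integral:
  assumes f: "bdd_meas01 f" and "0 \<le> x" "x \<le> y" "y \<le> 1"
  shows "integral {0..y} f - integral {0..x} f = integral {x..y} f"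
  using Henstock_Kurzweil_Integration.integral_combine[of 0 x y f] bdd_meas01_integrable_on[OF f, of 0 y] assms
  by simp

lemma integral_bound_bdd_meas01:
  assumes f: "bdd_meas01 f" and "0 \<le> x" "x \<le> y" "y \<le> 1"
    and "\<And>s. s \<in> {x..y} \<Longrightarrow> \<bar>f s\<bar> \<le> B"
  shows "\<bar>integral {x..y} f\<bar> \<le> B * (y - x)"
proof -
  have "norm (integral {x..y} f) \<le> integral {x..y} (\<lambda>s. B)"
    using assms by (intro Henstock_Kurzweil_Integration.integral_norm_bound_integral bdd_meas01_integrable_on bdd_meas01_const) auto
  then show ?thesis using assms by (simp add: mult.commute)
qed

lemma sum_integral_grid:
  fixes f :: "real \<Rightarrow> real" and n m :: nat
  assumes f: "bdd_meas01 f" and n: "n > 0" and m: "m \<le> n"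
  shows "(\<Sum>i<m. integral {real i / n..real (Suc i) / n} f) = integral {0..real m / n} f"
  using m
proof (induction m)
  case (Suc m)
  then show ?case
    using integral_diff_eq_integral[OF f, of "real m / n" "real (Suc m) / n"] n
    by (simp add: divide_simps)
qed simp

text \<open>Together with the next lemma this replaces the calculus of absolutely continuous functions:
  functions with bounded derivative satisfy the usual rules up to errors quadratic in the length
  of the interval.\<close>

lemma constant_if_quadratic_increments:
  fixes G :: "real \<Rightarrow> real"
  assumes G: "\<And>x y. \<lbrakk>0 \<le> x; x \<le> y; y \<le> 1\<rbrakk> \<Longrightarrow> \<bar>G y - G x\<bar> \<le> K * (y - x)^2"
    and "x \<in> {0..1}"
  shows "G x = G 0"
proof -
  have "(G has_real_derivative 0) (at y within {0..1})" if y: "y \<in> {0..1}" for y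
    unfolding has_field_derivative_iff
  proof (rule Lim_null_comparison)
    show "((\<lambda>z. K * \<bar>z - y\<bar>) \<longlongrightarrow> 0) (at y within {0..1})"
      by (auto intro!: tendsto_eq_intros)
    show "\<forall>\<^sub>F z in at y within {0..1}. norm ((G z - G y) / (z - y)) \<le> K * \<bar>z - y\<bar>"
      unfolding eventually_at_filter
    proof (intro always_eventually allI impI)
      fix z :: real assume z: "z \<noteq> y" "z \<in> {0..1}"
      have "\<bar>G z - G y\<bar> \<le> K * (z - y)^2"
        using G[of y z] G[of z y] y z by (cases "y \<le> z") (auto simp: abs_minus_commute power2_commute)
      also have "\<dots> = K * \<bar>z - y\<bar> * \<bar>z - y\<bar>" by (simp add: power2_eq_square)
      finally show "norm ((G z - G y) / (z - y)) \<le> K * \<bar>z - y\<bar>"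
        using z by (simp add: abs_divide pos_divide_le_eq)
    qed
  qed
  then show ?thesis
    using has_field_derivative_zero_constant[of "{0..1::real}" G] assms(2) by (metis atLeastAtMost_iff convex_real_interval(5) order_refl zero_le_one)
qed

text \<open>The product rule when \<open>W\<close> is only an indefinite integral, so that \<open>W' = f\<close> is available
  only almost everywhere. The difference of the two sides, as a function of the upper limit,
  has quadratic increments and is therefore constant.\<close>

lemma integral_by_parts_bounded:
  fixes u u' W f :: "real \<Rightarrow> real"
  assumes u: "\<And>x. x \<in> {0..1} \<Longrightarrow> (u has_real_derivative u' x) (at x within {0..1})"
    and u': "continuous_on {0..1} u'"
    and f: "bdd_meas01 f"
    and W: "\<And>x. x \<in> {0..1} \<Longrightarrow> W x = W 0 + integral {0..x} f"
    and xy: "0 \<le> x" "x \<le> y" "y \<le> 1"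
  shows "u y * W y - u x * W x = integral {x..y} (\<lambda>s. u' s * W s + u s * f s)"
proof -
  obtain F where F: "F > 0" "\<And>x. x \<in> {0..1} \<Longrightarrow> \<bar>f x\<bar> \<le> F" using bdd_meas01_bound[OF f] by blast
  have bu': "bdd_meas01 u'" by (rule bdd_meas01_continuous[OF u'])
  obtain U where U: "U > 0" "\<And>x. x \<in> {0..1} \<Longrightarrow> \<bar>u' x\<bar> \<le> U" using bdd_meas01_bound[OF bu'] by blast
  have incW: "W y - W x = integral {x..y} f" if "0 \<le> x" "x \<le> y" "y \<le> 1" for x y
    using W[of x] W[of y] integral_diff_eq_integral[OF f, of x y] that by simp
  have lipW: "\<bar>W y - W x\<bar> \<le> F * (y - x)" if "0 \<le> x" "x \<le> y" "y \<le> 1" for x y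
    unfolding incW[OF that] using that F by (intro integral_bound_bdd_meas01 f) auto
  have incu: "u y - u x = integral {x..y} u'" if "0 \<le> x" "x \<le> y" "y \<le> 1" for x y
  proof (rule integral_unique[symmetric], rule fundamental_theorem_of_calculus)
    fix s assume s: "s \<in> {x..y}"
    with that have "(u has_real_derivative u' s) (at s within {x..y})"
      by (intro DERIV_subset[OF u[of s]]) auto
    then show "(u has_vector_derivative u' s) (at s within {x..y})"
      by (simp add: has_real_derivative_iff_has_vector_derivative)
  qed (rule that)
  have lipu: "\<bar>u y - u x\<bar> \<le> U * (y - x)" if "0 \<le> x" "x \<le> y" "y \<le> 1" for x y
    unfolding incu[OF that] using that U by (intro integral_bound_bdd_meas01 bu') auto
  have bu: "bdd_meas01 u"
    using u by (intro bdd_meas01_continuous) (meson DERIV_continuous_on)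
  have "continuous_on {0..1} (\<lambda>x. W 0 + integral {0..x} f)"
    by (intro continuous_intros indefinite_integral_continuous_1 bdd_meas01_integrable_on f) auto
  then have "continuous_on {0..1} W" using W by (metis (no_types, lifting) continuous_on_cong)
  then have bW: "bdd_meas01 W" by (rule bdd_meas01_continuous)
  let ?h = "\<lambda>s. u' s * W s + u s * f s"
  have bh: "bdd_meas01 ?h" by (intro bdd_meas01_intros bu bu' bW f)
  define G where "G x = u x * W x - integral {0..x} ?h" for x
  have "G x = G 0" if "x \<in> {0..1}" for x
  proof (rule constant_if_quadratic_increments[OF _ that])
    fix x y :: real assume xy: "0 \<le> x" "x \<le> y" "y \<le> 1"
    let ?k = "\<lambda>s. u' s * (W y - W s) + (u x - u s) * f s"
    \<comment> \<open>Freezing \<open>W\<close> at \<open>y\<close> and \<open>u\<close> at \<open>x\<close> leaves an integrand of the order of \<open>y - x\<close>.\<close>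
    have "G y - G x = (u y - u x) * W y + u x * (W y - W x) - integral {x..y} ?h"
      using integral_diff_eq_integral[OF bh xy] by (simp add: G_def algebra_simps)
    also have "\<dots> = integral {x..y} (\<lambda>s. u' s * W y) + integral {x..y} (\<lambda>s. u x * f s) - integral {x..y} ?h"
      by (simp add: incu[OF xy] incW[OF xy])
    also have "\<dots> = integral {x..y} (\<lambda>s. u' s * W y + u x * f s) - integral {x..y} ?h"
      using xy by (subst Henstock_Kurzweil_Integration.integral_add)
        (auto intro!: bdd_meas01_integrable_on[OF bdd_meas01_mult] bdd_meas01_const bu' f)
    also have "\<dots> = integral {x..y} (\<lambda>s. u' s * W y + u x * f s - ?h s)"
      using xy by (subst Henstock_Kurzweil_Integration.integral_diff)
        (auto intro!: bdd_meas01_integrable_on bdd_meas01_intros bu bu' bW f)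
    also have "\<dots> = integral {x..y} ?k" by (simp add: algebra_simps)
    also have "\<bar>\<dots>\<bar> \<le> (U * (F * (y - x)) + U * (y - x) * F) * (y - x)"
    proof (rule integral_bound_bdd_meas01)
      fix s assume s: "s \<in> {x..y}"
      have s01: "s \<in> {0..1}" using s xy by auto
      have "F * (y - s) \<le> F * (y - x)" "U * (s - x) \<le> U * (y - x)"
        using s U(1) F(1) by (auto intro: mult_left_mono)
      then have "\<bar>W y - W s\<bar> \<le> F * (y - x)" "\<bar>u x - u s\<bar> \<le> U * (y - x)"
        using lipW[of s y] lipu[of x s] s xy by auto
      then have "\<bar>u' s * (W y - W s)\<bar> \<le> U * (F * (y - x))" "\<bar>(u x - u s) * f s\<bar> \<le> U * (y - x) * F"
        unfolding abs_mult using U(2)[OF s01] F(2)[OF s01] U(1) xy by (auto intro!: mult_mono)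
      then show "\<bar>?k s\<bar> \<le> U * (F * (y - x)) + U * (y - x) * F"
        by (intro order.trans[OF abs_triangle_ineq] add_mono)
    qed (use xy in \<open>auto intro!: bdd_meas01_intros bu bu' bW f\<close>)
    finally show "\<bar>G y - G x\<bar> \<le> (2 * U * F) * (y - x)^2"
      by (simp add: power2_eq_square algebra_simps)
  qed
  from this[of x] this[of y] show ?thesis
    using xy integral_diff_eq_integral[OF bh xy] by (simp add: G_def)
qed

section \<open>Step functions that sample a given function\<close>

text \<open>A measurable function is an almost everywhere limit of continuous ones; truncating these at the
  bound of \<open>f\<close> makes dominated convergence applicable.\<close>

lemma L1_continuous_approximation:
  fixes f :: "real \<Rightarrow> real"
  assumes f: "bdd_meas01 f" and e: "e > 0"
  obtains g where "continuous_on {0..1} g" "integral {0..1} (\<lambda>x. \<bar>f x - g x\<bar>) < e"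
proof -
  obtain B where B: "B > 0" "\<And>x. x \<in> {0..1} \<Longrightarrow> \<bar>f x\<bar> \<le> B" using bdd_meas01_bound[OF f] by blast
  have "f measurable_on {0..1}"
    using f by (subst measurable_on_iff_borel_measurable) (auto simp: bdd_meas01_def)
  then obtain N g where N: "negligible N" and g: "\<And>n. continuous_on UNIV (g n)"
    and lim: "\<And>x. x \<notin> N \<Longrightarrow> (\<lambda>n. g n x) \<longlonglongrightarrow> (if x \<in> {0..1} then f x else 0)"
    unfolding measurable_on_def by auto
  define c where "c n x = max (-B) (min B (g n x))" for n :: nat and x
  have c: "continuous_on {0..1} (c n)" for n
    unfolding c_def by (intro continuous_intros continuous_on_subset[OF g]) auto
  define h where "h n x = (if x \<in> N then 0 else \<bar>f x - c n x\<bar>)" for n x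
  have int: "(\<lambda>x. \<bar>f x - c n x\<bar>) integrable_on {0..1}" for n
    by (intro bdd_meas01_integrable_on bdd_meas01_intros f bdd_meas01_continuous c) auto
  have "(\<lambda>n. integral {0..1} (h n)) \<longlonglongrightarrow> integral {0..1} (\<lambda>x::real. 0)"
  proof (rule dominated_convergence(2)[where f = h and g = "\<lambda>x. 0" and h = "\<lambda>x. 2 * B"])
    show "h n integrable_on {0..1}" for n
      by (rule integrable_spike[OF int N]) (auto simp: h_def)
    show "norm (h n x) \<le> 2 * B" if "x \<in> {0..1}" for n x
      using B(1) B(2)[OF that] by (auto simp: h_def c_def max_def min_def)
    show "(\<lambda>n. h n x) \<longlonglongrightarrow> 0" if x: "x \<in> {0..1}" for x
    proof (cases "x \<in> N")
      case False
      have "(\<lambda>n. g n x) \<longlonglongrightarrow> f x" using lim[OF False] x by simp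
      then have "(\<lambda>n. \<bar>f x - c n x\<bar>) \<longlonglongrightarrow> \<bar>f x - max (-B) (min B (f x))\<bar>"
        unfolding c_def by (intro tendsto_intros)
      moreover have "f x - max (-B) (min B (f x)) = 0"
        using B(2)[OF x] by (auto simp: max_def min_def)
      ultimately show ?thesis using False by (simp add: h_def)
    qed (simp add: h_def)
  qed auto
  moreover have "integral {0..1} (h n) = integral {0..1} (\<lambda>x. \<bar>f x - c n x\<bar>)" for n
    by (rule integral_spike[OF N]) (auto simp: h_def)
  ultimately have "(\<lambda>n. integral {0..1} (\<lambda>x. \<bar>f x - c n x\<bar>)) \<longlonglongrightarrow> 0" by simp
  from order_tendstoD(2)[OF this e] obtain n where "integral {0..1} (\<lambda>x. \<bar>f x - c n x\<bar>) < e"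
    by (auto dest: eventually_happens)
  with c show ?thesis by (rule that)
qed

lemma below_average_point:
  fixes h :: "real \<Rightarrow> real"
  assumes h: "bdd_meas01 h" and ab: "0 \<le> a" "a < b" "b \<le> 1"
    and N: "negligible N" and m: "integral {a..b} h < m * (b - a)"
  obtains t where "t \<in> {a<..<b} - N" "h t \<le> m"
proof (rule ccontr)
  assume "\<not> thesis"
  with that have none: "m < h t" if "t \<in> {a<..<b} - N" for t using that not_less by blast
  define k where "k t = (if t \<in> insert a (insert b N) then m else h t)" for t
  have N': "negligible (insert a (insert b N))" using N by simp
  have hi: "h integrable_on {a..b}" using ab by (intro bdd_meas01_integrable_on[OF h]) auto
  have "m * (b - a) = integral {a..b} (\<lambda>t. m)" using ab by simp
  also have "\<dots> \<le> integral {a..b} k"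
  proof (rule integral_le)
    show "k integrable_on {a..b}" by (rule integrable_spike[OF hi N']) (auto simp: k_def)
    show "m \<le> k t" if "t \<in> {a..b}" for t
    proof (cases "t \<in> insert a (insert b N)")
      case False
      with that have "t \<in> {a<..<b} - N" by auto
      with none[of t] False show ?thesis by (simp add: k_def)
    qed (simp add: k_def)
  qed auto
  also have "\<dots> = integral {a..b} h" by (rule integral_spike[OF N']) (auto simp: k_def)
  finally show False using m by simp
qed

text \<open>Sampling at arbitrary points of a fine grid would not do for discontinuous \<open>f\<close>. If \<open>g\<close> is a continuous
  \<open>L\<^sup>1\<close>-approximation of \<open>f\<close>, each grid interval contains a point outside \<open>N\<close> at which \<open>\<bar>f - g\<bar>\<close> does not
  exceed its mean by much, and the value of \<open>f\<close> there is a good constant for the whole interval.\<close>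

lemma step_function_approximation:
  fixes f :: "real \<Rightarrow> real"
  assumes f: "bdd_meas01 f" and N: "negligible N" and e: "e > 0"
  obtains n t where "n > 0" "\<And>i. i < n \<Longrightarrow> t i \<in> {real i / n<..<real (Suc i) / n} - N"
    "(\<Sum>i<n. integral {real i / n..real (Suc i) / n} (\<lambda>x. \<bar>f x - f (t i)\<bar>)) \<le> e"
proof -
  have e4: "e / 4 > 0" using e by simp
  obtain g where g: "continuous_on {0..1} g" and fg: "integral {0..1} (\<lambda>x. \<bar>f x - g x\<bar>) < e / 4"
    using L1_continuous_approximation[OF f e4] .
  have bg: "bdd_meas01 g" by (rule bdd_meas01_continuous[OF g])
  let ?h = "\<lambda>x. \<bar>f x - g x\<bar>"
  have bh: "bdd_meas01 ?h" by (intro bdd_meas01_intros f bg)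
  from compact_uniformly_continuous[OF g] e4 obtain d where d: "d > 0"
    "\<And>x y. \<lbrakk>x \<in> {0..1}; y \<in> {0..1}; \<bar>y - x\<bar> < d\<rbrakk> \<Longrightarrow> \<bar>g y - g x\<bar> < e / 4"
    unfolding uniformly_continuous_on_def dist_real_def by (metis compact_Icc)
  obtain n0 where n0: "inverse (real (Suc n0)) < d" using reals_Archimedean[OF d(1)] by blast
  define n where "n = Suc n0"
  have n: "n > 0" "1 / real n < d" using n0 by (simp_all add: n_def inverse_eq_divide)
  define a where "a i = real i / n" for i
  have a: "0 \<le> a i" "a i < a (Suc i)" "a (Suc i) - a i = 1 / n" for i
    using n by (auto simp: a_def divide_simps)
  have a1: "a (Suc i) \<le> 1" if "i < n" for i using that n by (simp add: a_def)
  define I where "I i = integral {a i..a (Suc i)} ?h" for i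
  \<comment> \<open>\<open>I i * n\<close> is the mean of \<open>\<bar>f - g\<bar>\<close> over the interval; the slack \<open>e / 4\<close> makes the inequality strict.\<close>
  have "\<exists>t. t \<in> {a i<..<a (Suc i)} - N \<and> ?h t \<le> I i * n + e / 4" if "i < n" for i
  proof (rule below_average_point[OF bh a(1) a(2) a1[OF that] N])
    show "integral {a i..a (Suc i)} ?h < (I i * n + e / 4) * (a (Suc i) - a i)"
      using e n by (simp add: a(3) I_def[symmetric] divide_simps)
  qed blast
  then obtain t where t: "\<And>i. i < n \<Longrightarrow> t i \<in> {a i<..<a (Suc i)} - N"
     "\<And>i. i < n \<Longrightarrow> ?h (t i) \<le> I i * n + e / 4" by metis
  have "integral {a i..a (Suc i)} (\<lambda>x. \<bar>f x - f (t i)\<bar>) \<le> 2 * I i + e / 2 / n" if i: "i < n" for i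
  proof -
    have ti: "t i \<in> {0..1}" "t i \<in> {a i..a (Suc i)}" using t(1)[OF i] a1[OF i] a(1)[of i] by auto
    have "integral {a i..a (Suc i)} (\<lambda>x. \<bar>f x - f (t i)\<bar>)
        \<le> integral {a i..a (Suc i)} (\<lambda>x. ?h x + (e / 4 + (I i * n + e / 4)))"
    proof (rule integral_le)
      fix x assume x: "x \<in> {a i..a (Suc i)}"
      then have "\<bar>x - t i\<bar> \<le> 1 / n" using ti(2) a(3)[of i] by auto
      then have "\<bar>g x - g (t i)\<bar> < e / 4"
        using x a(1)[of i] a1[OF i] n by (intro d(2) ti) auto
      with t(2)[OF i] show "\<bar>f x - f (t i)\<bar> \<le> ?h x + (e / 4 + (I i * n + e / 4))" by linarith
    qed (use a a1[OF i] in \<open>auto intro!: bdd_meas01_integrable_on bdd_meas01_add bdd_meas01_diff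
         bdd_meas01_abs bdd_meas01_const f bg\<close>)
    also have "\<dots> = I i + (e / 4 + (I i * n + e / 4)) * (a (Suc i) - a i)"
      using a[of i] a1[OF i] unfolding I_def
      by (subst Henstock_Kurzweil_Integration.integral_add) (auto intro!: bdd_meas01_integrable_on bdd_meas01_const bh)
    also have "\<dots> = 2 * I i + e / 2 / n" using n by (simp add: a(3) field_simps)
    finally show ?thesis .
  qed
  then have "(\<Sum>i<n. integral {a i..a (Suc i)} (\<lambda>x. \<bar>f x - f (t i)\<bar>)) \<le> (\<Sum>i<n. 2 * I i + e / 2 / n)"
    by (intro sum_mono) auto
  also have "\<dots> = 2 * (\<Sum>i<n. I i) + e / 2" using n by (simp add: sum.distrib sum_distrib_left)
  also have "(\<Sum>i<n. I i) = integral {0..1} ?h"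
    unfolding I_def a_def using sum_integral_grid[OF bh n(1) order_refl] n by simp
  also have "2 * \<dots> + e / 2 \<le> e" using fg by simp
  finally show ?thesis using t(1) n(1) unfolding a_def by (intro that[of n t]) auto
qed

section \<open>Initial value problems with a bounded measurable coefficient\<close>

lemma continuous_inner_integral:
  assumes q: "bdd_meas01 q" and g: "continuous_on {0..1} g"
  shows "continuous_on {0..1} (\<lambda>t. integral {0..t} (\<lambda>s. q s * g s))"
proof (rule indefinite_integral_continuous_1)
  show "(\<lambda>s. q s * g s) integrable_on {0..1}"
    by (rule bdd_meas01_integrable_on[OF bdd_meas01_mult[OF q bdd_meas01_continuous[OF g]]]) simp_all
qed

text \<open>The equation \<open>v'' + \<mu> q v = 0\<close>, with \<open>w\<close> standing for \<open>v'\<close>, in integrated form. This avoids second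
  derivatives, which exist only almost everywhere.\<close>

definition sl_solution :: "(real \<Rightarrow> real) \<Rightarrow> real \<Rightarrow> (real \<Rightarrow> real) \<Rightarrow> (real \<Rightarrow> real) \<Rightarrow> bool" where
  "sl_solution q \<mu> v w \<longleftrightarrow>
     (\<forall>x\<in>{0..1}. (v has_real_derivative w x) (at x within {0..1})) \<and>
     (\<forall>x\<in>{0..1}. w x = w 0 - \<mu> * integral {0..x} (\<lambda>s. q s * v s))"

lemma sl_solutionD:
  assumes "sl_solution q \<mu> v w" "x \<in> {0..1}"
  shows "(v has_real_derivative w x) (at x within {0..1})"
    and "w x = w 0 - \<mu> * integral {0..x} (\<lambda>s. q s * v s)"
  using assms unfolding sl_solution_def by blast+

lemma sl_solution_continuous:
  assumes q: "bdd_meas01 q" and s: "sl_solution q \<mu> v w"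
  shows "continuous_on {0..1} v" "continuous_on {0..1} w"
proof -
  show v: "continuous_on {0..1} v"
    by (rule DERIV_continuous_on) (rule sl_solutionD(1)[OF s])
  have "continuous_on {0..1} (\<lambda>x. w 0 - \<mu> * integral {0..x} (\<lambda>s. q s * v s))"
    by (intro continuous_on_diff continuous_on_mult continuous_on_const continuous_inner_integral q v)
  then show "continuous_on {0..1} w"
    by (rule continuous_on_eq) (rule sl_solutionD(2)[OF s, symmetric])
qed

text \<open>The Wronskian \<open>v y' - v' y\<close> has derivative \<open>(\<mu> - \<nu>) q v y\<close>. For \<open>\<mu> = \<nu>\<close> it is constant, which is
  how uniqueness of solutions is obtained below.\<close>

lemma lagrange_identity:
  assumes q: "bdd_meas01 q" and s1: "sl_solution q \<mu> v w" and s2: "sl_solution q \<nu> y z" and x: "x \<in> {0..1}"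
  shows "v x * z x - w x * y x = v 0 * z 0 - w 0 * y 0 + (\<mu> - \<nu>) * integral {0..x} (\<lambda>s. q s * v s * y s)"
proof -
  note c = sl_solution_continuous[OF q s1] sl_solution_continuous[OF q s2]
  note bc = c[THEN bdd_meas01_continuous]
  have b: "bdd_meas01 (\<lambda>s. - \<nu> * (q s * y s))" "bdd_meas01 (\<lambda>s. - \<mu> * (q s * v s))"
    by (intro bdd_meas01_mult bdd_meas01_const q bc)+
  have z: "z x = z 0 + integral {0..x} (\<lambda>s. - \<nu> * (q s * y s))" if "x \<in> {0..1}" for x
    using sl_solutionD(2)[OF s2 that] by simp
  have w: "w x = w 0 + integral {0..x} (\<lambda>s. - \<mu> * (q s * v s))" if "x \<in> {0..1}" for x
    using sl_solutionD(2)[OF s1 that] by simp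
  have 1: "v x * z x - v 0 * z 0 = integral {0..x} (\<lambda>s. w s * z s + v s * (- \<nu> * (q s * y s)))"
    using x by (intro integral_by_parts_bounded[OF sl_solutionD(1)[OF s1] c(2) b(1) z]) auto
  have 2: "y x * w x - y 0 * w 0 = integral {0..x} (\<lambda>s. z s * w s + y s * (- \<mu> * (q s * v s)))"
    using x by (intro integral_by_parts_bounded[OF sl_solutionD(1)[OF s2] c(4) b(2) w]) auto
  have "(v x * z x - v 0 * z 0) - (y x * w x - y 0 * w 0)
      = integral {0..x} (\<lambda>s. (w s * z s + v s * (- \<nu> * (q s * y s))) - (z s * w s + y s * (- \<mu> * (q s * v s))))"
    unfolding 1 2
    by (subst Henstock_Kurzweil_Integration.integral_diff)
       (use x in \<open>auto intro!: bdd_meas01_integrable_on bdd_meas01_add bdd_meas01_diff bdd_meas01_mult bdd_meas01_minus bdd_meas01_const q bc\<close>)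
  also have "\<dots> = integral {0..x} (\<lambda>s. (\<mu> - \<nu>) * (q s * v s * y s))"
    by (simp add: algebra_simps)
  also have "\<dots> = (\<mu> - \<nu>) * integral {0..x} (\<lambda>s. q s * v s * y s)" by simp
  finally show ?thesis by (simp add: algebra_simps)
qed

definition double_integral :: "(real \<Rightarrow> real) \<Rightarrow> (real \<Rightarrow> real) \<Rightarrow> real \<Rightarrow> real" where
  "double_integral q g x = integral {0..x} (\<lambda>t. integral {0..t} (\<lambda>s. q s * g s))"

lemma continuous_double_integral:
  assumes "bdd_meas01 q" "continuous_on {0..1} g"
  shows "continuous_on {0..1} (double_integral q g)"
  unfolding double_integral_def
  by (rule indefinite_integral_continuous_1[OF
      integrable_continuous_real[OF continuous_inner_integral[OF assms]]])

lemma double_integral_add_mult: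
  assumes q: "bdd_meas01 q" and g: "continuous_on {0..1} g" and h: "continuous_on {0..1} h" and x: "x \<in> {0..1}"
  shows "double_integral q (\<lambda>s. g s + c * h s) x = double_integral q g x + c * double_integral q h x"
proof -
  note b = g[THEN bdd_meas01_continuous] h[THEN bdd_meas01_continuous]
  note ci = g[THEN continuous_inner_integral[OF q], THEN bdd_meas01_continuous]
    h[THEN continuous_inner_integral[OF q], THEN bdd_meas01_continuous]
  have "integral {0..t} (\<lambda>s. q s * (g s + c * h s))
      = integral {0..t} (\<lambda>s. q s * g s) + c * integral {0..t} (\<lambda>s. q s * h s)" if "t \<in> {0..x}" for t
  proof -
    have "integral {0..t} (\<lambda>s. q s * (g s + c * h s)) = integral {0..t} (\<lambda>s. q s * g s + c * (q s * h s))"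
      by (simp add: algebra_simps)
    also have "\<dots> = integral {0..t} (\<lambda>s. q s * g s) + integral {0..t} (\<lambda>s. c * (q s * h s))"
      using that x by (intro Henstock_Kurzweil_Integration.integral_add bdd_meas01_integrable_on bdd_meas01_mult
        bdd_meas01_const q b) auto
    finally show ?thesis by simp
  qed
  then have "double_integral q (\<lambda>s. g s + c * h s) x
      = integral {0..x} (\<lambda>t. integral {0..t} (\<lambda>s. q s * g s) + c * integral {0..t} (\<lambda>s. q s * h s))"
    unfolding double_integral_def by (intro integral_cong) auto
  also have "\<dots> = double_integral q g x + integral {0..x} (\<lambda>t. c * integral {0..t} (\<lambda>s. q s * h s))"
    unfolding double_integral_def using x
    by (intro Henstock_Kurzweil_Integration.integral_add bdd_meas01_integrable_on bdd_meas01_mult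
        bdd_meas01_const ci) auto
  finally show ?thesis by (simp add: double_integral_def)
qed

lemma double_integral_bound:
  assumes q: "bdd_meas01 q" "\<And>s. s \<in> {0..1} \<Longrightarrow> \<bar>q s\<bar> \<le> M"
    and g: "continuous_on {0..1} g" "\<And>s. s \<in> {0..1} \<Longrightarrow> \<bar>g s\<bar> \<le> A * s ^ n"
    and x: "x \<in> {0..1}"
  shows "\<bar>double_integral q g x\<bar> \<le> M * A * x ^ Suc n / Suc n"
proof -
  have M: "M \<ge> 0" using q(2)[of 0] by auto
  have A: "A \<ge> 0" using g(2)[of 1] by auto
  have pow: "((\<lambda>s. M * A * s ^ n) has_integral M * A * t ^ Suc n / Suc n) {0..t}" if "0 \<le> t" for t :: real
  proof -
    have "((\<lambda>t. M * A * t ^ Suc n / Suc n) has_real_derivative M * A * s ^ n) (at s within {0..t})" for s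
      by (rule derivative_eq_intros refl | simp del: of_nat_Suc)+
    then show ?thesis
      using fundamental_theorem_of_calculus[OF that, of "\<lambda>t. M * A * t ^ Suc n / Suc n" "\<lambda>s. M * A * s ^ n"]
      by (simp only: has_real_derivative_iff_has_vector_derivative) simp
  qed
  have inner: "\<bar>integral {0..t} (\<lambda>s. q s * g s)\<bar> \<le> M * A * x ^ Suc n / Suc n" if t: "t \<in> {0..x}" for t
  proof -
    have "norm (integral {0..t} (\<lambda>s. q s * g s)) \<le> integral {0..t} (\<lambda>s. M * A * s ^ n)"
    proof (rule Henstock_Kurzweil_Integration.integral_norm_bound_integral)
      show "norm (q s * g s) \<le> M * A * s ^ n" if "s \<in> {0..t}" for s
        using mult_mono[OF q(2) g(2), of s s] M t that x by (simp add: abs_mult mult_ac)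
      show "(\<lambda>s. q s * g s) integrable_on {0..t}"
        using t x by (intro bdd_meas01_integrable_on bdd_meas01_mult q bdd_meas01_continuous[OF g(1)]) auto
      show "(\<lambda>s. M * A * s ^ n) integrable_on {0..t}"
        using has_integral_integrable[OF pow[of t]] t by simp
    qed
    also have "\<dots> = M * A * t ^ Suc n / Suc n" using t by (intro integral_unique pow) auto
    also have "\<dots> \<le> M * A * x ^ Suc n / Suc n"
      using t M A by (intro divide_right_mono mult_left_mono power_mono) auto
    finally show ?thesis by simp
  qed
  have "\<bar>double_integral q g x\<bar> \<le> M * A * x ^ Suc n / Suc n * (x - 0)"
    unfolding double_integral_def using x inner
    by (intro integral_bound_bdd_meas01[OF bdd_meas01_continuous[OF continuous_inner_integral[OF q(1) g(1)]]]) auto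
  also have "\<dots> \<le> M * A * x ^ Suc n / Suc n"
    using x M A by (intro mult_right_le_one_le divide_nonneg_nonneg mult_nonneg_nonneg) auto
  finally show ?thesis .
qed

text \<open>The coefficients of the solution as a power series in \<open>- \<mu>\<close>: substituting the series into
  \<open>v x = a + b x - \<mu> \<integral>\<^sub>0\<^sup>x \<integral>\<^sub>0\<^sup>t q v\<close> and comparing powers of \<open>\<mu>\<close> gives this recursion.\<close>

primrec picard_term :: "(real \<Rightarrow> real) \<Rightarrow> real \<Rightarrow> real \<Rightarrow> nat \<Rightarrow> real \<Rightarrow> real" where
  "picard_term q a b 0 = (\<lambda>x. a + b * x)"
| "picard_term q a b (Suc n) = double_integral q (picard_term q a b n)"

lemma continuous_picard_term:
  "bdd_meas01 q \<Longrightarrow> continuous_on {0..1} (picard_term q a b n)"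
  by (induction n) (auto intro!: continuous_intros continuous_double_integral)

lemma picard_term_bound:
  assumes q: "bdd_meas01 q" "\<And>s. s \<in> {0..1} \<Longrightarrow> \<bar>q s\<bar> \<le> M" and "x \<in> {0..1}"
  shows "\<bar>picard_term q a b n x\<bar> \<le> (\<bar>a\<bar> + \<bar>b\<bar>) * M ^ n / fact n * x ^ n"
  using assms(3)
proof (induction n arbitrary: x)
  case 0
  then have "\<bar>b * x\<bar> \<le> \<bar>b\<bar>" by (simp add: abs_mult mult_right_le_one_le)
  then show ?case using abs_triangle_ineq[of a "b * x"] by simp
next
  case (Suc n)
  have "\<bar>double_integral q (picard_term q a b n) x\<bar>
      \<le> M * ((\<bar>a\<bar> + \<bar>b\<bar>) * M ^ n / fact n) * x ^ Suc n / Suc n"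
    by (rule double_integral_bound[OF q continuous_picard_term[OF q(1)] Suc.IH Suc.prems])
  then show ?case by (simp add: mult_ac)
qed

definition shoot :: "(real \<Rightarrow> real) \<Rightarrow> real \<Rightarrow> real \<Rightarrow> real \<Rightarrow> real \<Rightarrow> real" where
  "shoot q a b \<mu> x = (\<Sum>n. (- \<mu>) ^ n * picard_term q a b n x)"

text \<open>The factorial in the bound for the Picard terms gives a summable majorant on bounded
  sets of \<open>\<mu>\<close>, so continuity in \<open>x\<close> and in \<open>\<mu>\<close> come together.\<close>

lemma uniform_limit_shoot:
  assumes q: "bdd_meas01 q"
  shows "uniform_limit ({-K..K} \<times> {0..1})
      (\<lambda>N (\<mu>, x). \<Sum>n<N. (- \<mu>) ^ n * picard_term q a b n x) (\<lambda>(\<mu>, x). shoot q a b \<mu> x) sequentially"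
proof -
  obtain M where M: "M > 0" "\<And>x. x \<in> {0..1} \<Longrightarrow> \<bar>q x\<bar> \<le> M" using bdd_meas01_bound[OF q] by blast
  let ?B = "\<bar>a\<bar> + \<bar>b\<bar>"
  have "uniform_limit ({-K..K} \<times> {0..1})
      (\<lambda>N p. \<Sum>n<N. (- fst p) ^ n * picard_term q a b n (snd p))
      (\<lambda>p. \<Sum>n. (- fst p) ^ n * picard_term q a b n (snd p)) sequentially"
  proof (rule Weierstrass_m_test)
    fix n :: nat and p assume "p \<in> {-K..K} \<times> {0..1::real}"
    then have p: "\<bar>fst p\<bar> \<le> K" "snd p \<in> {0..1}" by auto
    have "\<bar>picard_term q a b n (snd p)\<bar> \<le> ?B * M ^ n / fact n * snd p ^ n"
      by (rule picard_term_bound[OF q M(2) p(2)])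
    also have "\<dots> \<le> ?B * M ^ n / fact n"
      using p(2) M by (intro mult_right_le_one_le) (auto intro: power_le_one)
    finally have "\<bar>picard_term q a b n (snd p)\<bar> \<le> ?B * M ^ n / fact n" .
    moreover have "\<bar>fst p\<bar> ^ n \<le> K ^ n" using p(1) by (intro power_mono) auto
    ultimately have "\<bar>fst p\<bar> ^ n * \<bar>picard_term q a b n (snd p)\<bar> \<le> K ^ n * (?B * M ^ n / fact n)"
      using p(1) by (intro mult_mono) auto
    then show "norm ((- fst p) ^ n * picard_term q a b n (snd p)) \<le> ?B * (inverse (fact n) * (K * M) ^ n)"
      by (simp add: abs_mult power_abs power_mult_distrib field_simps)
  next
    show "summable (\<lambda>n. ?B * (inverse (fact n) * (K * M) ^ n))"
      by (intro summable_mult summable_exp)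
  qed
  then show ?thesis by (simp only: shoot_def case_prod_beta')
qed

lemma uniform_limit_shoot_fixed:
  assumes q: "bdd_meas01 q"
  shows "uniform_limit {0..1} (\<lambda>N x. \<Sum>n<N. (- \<mu>) ^ n * picard_term q a b n x) (shoot q a b \<mu>) sequentially"
  using uniform_limit_shoot[OF q, where K = "\<bar>\<mu>\<bar>" and a = a and b = b]
  unfolding uniform_limit_iff by (fastforce elim: eventually_mono)

lemma continuous_shoot_joint:
  assumes q: "bdd_meas01 q"
  shows "continuous_on ({-K..K} \<times> {0..1}) (\<lambda>(\<mu>, x). shoot q a b \<mu> x)"
proof (rule uniform_limit_theorem[OF _ uniform_limit_shoot[OF q]])
  show "\<forall>\<^sub>F N in sequentially. continuous_on ({-K..K} \<times> {0..1})
      (\<lambda>(\<mu>, x). \<Sum>n<N. (- \<mu>) ^ n * picard_term q a b n x)"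
    unfolding split_beta
    by (intro always_eventually allI continuous_intros
      continuous_on_compose2[OF continuous_picard_term[OF q]]) auto
qed simp

lemma continuous_shoot:
  assumes q: "bdd_meas01 q"
  shows "continuous_on {0..1} (shoot q a b \<mu>)"
  by (rule uniform_limit_theorem[OF _ uniform_limit_shoot_fixed[OF q]])
     (auto intro!: always_eventually continuous_intros continuous_picard_term q)

lemma uniform_limit_shoot_parameter:
  assumes q: "bdd_meas01 q"
  shows "uniform_limit {0..1} (shoot q a b) (shoot q a b \<nu>) (at \<nu>)"
proof (rule uniform_limitI)
  fix e :: real assume e: "e > 0"
  define K where "K = \<bar>\<nu>\<bar> + 1"
  have "uniformly_continuous_on ({-K..K} \<times> {0..1}) (\<lambda>(\<mu>, x). shoot q a b \<mu> x)"
    by (intro compact_uniformly_continuous continuous_shoot_joint q compact_Times) auto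
  with e obtain d where d: "d > 0" "\<And>p p'. \<lbrakk>p \<in> {-K..K} \<times> {0..1}; p' \<in> {-K..K} \<times> {0..1}; dist p' p < d\<rbrakk> \<Longrightarrow>
     dist (case p' of (\<mu>, x) \<Rightarrow> shoot q a b \<mu> x) (case p of (\<mu>, x) \<Rightarrow> shoot q a b \<mu> x) < e"
    unfolding uniformly_continuous_on_def by metis
  show "\<forall>\<^sub>F \<mu> in at \<nu>. \<forall>x\<in>{0..1}. dist (shoot q a b \<mu> x) (shoot q a b \<nu> x) < e"
    unfolding eventually_at
  proof (intro exI[of _ "min d 1"] conjI ballI impI)
    fix \<mu> x :: real assume \<mu>: "\<mu> \<noteq> \<nu> \<and> dist \<mu> \<nu> < min d 1" and x: "x \<in> {0..1}"
    have "dist (case (\<mu>, x) of (\<mu>, x) \<Rightarrow> shoot q a b \<mu> x) (case (\<nu>, x) of (\<mu>, x) \<Rightarrow> shoot q a b \<mu> x) < e"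
      using \<mu> x by (intro d(2)) (auto simp: K_def dist_real_def dist_Pair_Pair)
    then show "dist (shoot q a b \<mu> x) (shoot q a b \<nu> x) < e" by simp
  qed (use d in auto)
qed

text \<open>The partial sums satisfy the integral equation with an index shift, and the double integral is
  continuous with respect to uniform convergence.\<close>

lemma shoot_integral_equation:
  assumes q: "bdd_meas01 q" and x: "x \<in> {0..1}"
  shows "shoot q a b \<mu> x = a + b * x - \<mu> * double_integral q (shoot q a b \<mu>) x"
proof -
  obtain M where M: "M > 0" "\<And>x. x \<in> {0..1} \<Longrightarrow> \<bar>q x\<bar> \<le> M" using bdd_meas01_bound[OF q] by blast
  define S where "S N x = (\<Sum>n<N. (- \<mu>) ^ n * picard_term q a b n x)" for N x
  have cS: "continuous_on {0..1} (S N)" for N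
    unfolding S_def by (intro continuous_intros continuous_picard_term q)
  have S_Suc: "S (Suc N) x = a + b * x - \<mu> * double_integral q (S N) x" for N
  proof (induction N)
    case 0
    then show ?case by (simp add: S_def double_integral_def)
  next
    case (Suc N)
    have "double_integral q (S (Suc N)) x
        = double_integral q (\<lambda>s. S N s + (- \<mu>) ^ N * picard_term q a b N s) x"
      by (simp add: S_def[abs_def])
    also have "\<dots> = double_integral q (S N) x + (- \<mu>) ^ N * picard_term q a b (Suc N) x"
      using double_integral_add_mult[OF q cS continuous_picard_term[OF q] x] by simp
    finally have "double_integral q (S (Suc N)) x
        = double_integral q (S N) x + (- \<mu>) ^ N * picard_term q a b (Suc N) x" .
    moreover have "S (Suc (Suc N)) x = S (Suc N) x + (- \<mu>) ^ Suc N * picard_term q a b (Suc N) x"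
      by (simp add: S_def)
    ultimately show ?case using Suc.IH by (simp add: algebra_simps)
  qed
  have lim: "uniform_limit {0..1} S (shoot q a b \<mu>) sequentially"
    unfolding S_def[abs_def] by (rule uniform_limit_shoot_fixed[OF q])
  have "(\<lambda>N. double_integral q (S N) x) \<longlonglongrightarrow> double_integral q (shoot q a b \<mu>) x"
  proof (rule LIMSEQ_I)
    fix e :: real assume e: "e > 0"
    then have "\<forall>\<^sub>F N in sequentially. \<forall>s\<in>{0..1}. dist (S N s) (shoot q a b \<mu> s) < e / (2 * M)"
      using lim M(1) by (auto simp: uniform_limit_iff)
    then obtain N0 where N0: "\<And>N s. N \<ge> N0 \<Longrightarrow> s \<in> {0..1} \<Longrightarrow> \<bar>S N s - shoot q a b \<mu> s\<bar> < e / (2 * M)"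
      unfolding eventually_sequentially dist_real_def by blast
    show "\<exists>N0. \<forall>N\<ge>N0. norm (double_integral q (S N) x - double_integral q (shoot q a b \<mu>) x) < e"
    proof (intro exI allI impI)
      fix N assume N: "N \<ge> N0"
      have "\<bar>double_integral q (\<lambda>s. S N s + (-1) * shoot q a b \<mu> s) x\<bar> \<le> M * (e / (2 * M)) * x ^ Suc 0 / Suc 0"
        using N0[OF N] by (intro double_integral_bound[OF q M(2) _ _ x])
          (auto intro!: continuous_intros cS continuous_shoot q less_imp_le)
      also have "\<dots> < e" using x e M(1) by (auto simp: field_simps)
      finally show "norm (double_integral q (S N) x - double_integral q (shoot q a b \<mu>) x) < e"
        using double_integral_add_mult[OF q cS continuous_shoot[OF q] x, where c = "-1"] by simp
    qed
  qed
  then have "(\<lambda>N. a + b * x - \<mu> * double_integral q (S N) x) \<longlonglongrightarrow> a + b * x - \<mu> * double_integral q (shoot q a b \<mu>) x"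
    by (intro tendsto_intros)
  then have 1: "(\<lambda>N. S (Suc N) x) \<longlonglongrightarrow> a + b * x - \<mu> * double_integral q (shoot q a b \<mu>) x"
    by (simp add: S_Suc)
  have "(\<lambda>N. S N x) \<longlonglongrightarrow> shoot q a b \<mu> x" by (rule tendsto_uniform_limitI[OF lim x])
  from LIMSEQ_Suc[OF this] 1 show ?thesis by (rule LIMSEQ_unique)
qed

definition shoot' :: "(real \<Rightarrow> real) \<Rightarrow> real \<Rightarrow> real \<Rightarrow> real \<Rightarrow> real \<Rightarrow> real" where
  "shoot' q a b \<mu> x = b - \<mu> * integral {0..x} (\<lambda>s. q s * shoot q a b \<mu> s)"

lemma shoot_solution:
  assumes q: "bdd_meas01 q"
  shows "sl_solution q \<mu> (shoot q a b \<mu>) (shoot' q a b \<mu>)"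
    and "shoot q a b \<mu> 0 = a" "shoot' q a b \<mu> 0 = b"
proof -
  show 0: "shoot q a b \<mu> 0 = a" "shoot' q a b \<mu> 0 = b"
    using shoot_integral_equation[OF q, of 0] by (simp_all add: double_integral_def shoot'_def)
  show "sl_solution q \<mu> (shoot q a b \<mu>) (shoot' q a b \<mu>)"
    unfolding sl_solution_def
  proof (intro conjI ballI)
    fix x :: real assume x: "x \<in> {0..1}"
    have "((\<lambda>x. a + b * x - \<mu> * double_integral q (shoot q a b \<mu>) x) has_real_derivative shoot' q a b \<mu> x) (at x within {0..1})"
      unfolding double_integral_def shoot'_def
      by (auto intro!: derivative_eq_intros integral_has_real_derivative[OF _ x]
         continuous_inner_integral continuous_shoot q)
    then show "(shoot q a b \<mu> has_real_derivative shoot' q a b \<mu> x) (at x within {0..1})"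
      by (rule has_field_derivative_transform_within[OF _ zero_less_one x])
         (simp add: shoot_integral_equation[OF q])
  qed (use 0 in \<open>simp add: shoot'_def\<close>)
qed

section \<open>Motion of the phase angle\<close>

lemma arctan_sinh_le:
  fixes x :: real
  assumes "0 \<le> x"
  shows "arctan (sinh x) \<le> x"
proof -
  have "(\<lambda>x. x - arctan (sinh x)) 0 \<le> x - arctan (sinh x)"
  proof (rule DERIV_nonneg_imp_nondecreasing[OF assms])
    fix y :: real
    have "((\<lambda>x. x - arctan (sinh x)) has_real_derivative 1 - cosh y / (1 + (sinh y)\<^sup>2)) (at y)"
      by (auto intro!: derivative_eq_intros simp: field_simps)
    moreover have "1 + (sinh y)\<^sup>2 = cosh y * cosh y"
      using cosh_square_eq[of y] by (simp add: power2_eq_square)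
    moreover have "cosh y \<le> cosh y * cosh y"
      using cosh_real_ge_1[of y] by simp
    ultimately show "\<exists>z. ((\<lambda>x. x - arctan (sinh x)) has_real_derivative z) (at y) \<and> 0 \<le> z"
      by (intro exI[of _ "1 - cosh y / (1 + (sinh y)\<^sup>2)"]) (auto simp: divide_le_eq)
  qed
  then show ?thesis by simp
qed

text \<open>With \<open>x = ln r / 2\<close> the argument of the arctangent is \<open>\<bar>sinh x\<bar>\<close>, and the Gudermannian
  \<open>arctan \<circ> sinh\<close> has derivative \<open>1 / cosh \<le> 1\<close>.\<close>

lemma arctan_half_log:
  fixes r :: real
  assumes r: "r > 0"
  shows "arctan (\<bar>r - 1\<bar> / (2 * sqrt r)) \<le> \<bar>ln r\<bar> / 2"
proof -
  have e: "exp (ln r / 2) = sqrt r" using r by (simp add: ln_sqrt[symmetric])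
  have "sinh (ln r / 2) = (r - 1) / (2 * sqrt r)"
    unfolding sinh_def exp_minus e using r by (simp add: field_simps)
  then have "\<bar>r - 1\<bar> / (2 * sqrt r) = \<bar>sinh (ln r / 2)\<bar>" using r by simp
  also have "\<dots> = sinh (\<bar>ln r\<bar> / 2)" by (auto simp: abs_if)
  finally show ?thesis using arctan_sinh_le[of "\<bar>ln r\<bar> / 2"] by simp
qed

text \<open>Multiplication of \<open>p + i r\<close> by \<open>exp (i \<alpha>)\<close>, written in real terms.\<close>

lemma polar_rotation:
  fixes p r \<alpha> :: real
  assumes "p \<noteq> 0 \<or> r \<noteq> 0"
  defines "\<tau> \<equiv> Arg (Complex p r)"
  obtains R where "R > 0" "p * cos \<alpha> - r * sin \<alpha> = R * cos (\<alpha> + \<tau>)" "p * sin \<alpha> + r * cos \<alpha> = R * sin (\<alpha> + \<tau>)"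
proof -
  obtain S t where S: "S > 0" and pr: "p = S * cos t" "r = S * sin t" and t: "t = \<tau>"
  proof
    show "cmod (Complex p r) > 0" using assms(1) by (auto simp: complex_eq_iff)
    have "Complex p r = rcis (cmod (Complex p r)) \<tau>" by (simp add: \<tau>_def rcis_cmod_Arg)
    then show "p = cmod (Complex p r) * cos \<tau>" "r = cmod (Complex p r) * sin \<tau>"
      by (metis Re_rcis complex.sel(1), metis Im_rcis complex.sel(2))
  qed simp
  show ?thesis
    by (rule that[OF S]) (simp_all add: pr t[symmetric] cos_add sin_add algebra_simps)
qed

text \<open>The constant is far from optimal; all that is used is that the change of angle is
  linear in the perturbation.\<close>

lemma angle_perturbation:
  fixes a b \<alpha> R d :: real
  assumes R: "R > 0" and nz: "a \<noteq> 0 \<or> b \<noteq> 0"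
    and d: "\<bar>a - R * cos \<alpha>\<bar> \<le> d" "\<bar>b - R * sin \<alpha>\<bar> \<le> d"
  obtains \<beta> S where "S > 0" "a = S * cos \<beta>" "b = S * sin \<beta>" "\<bar>\<beta> - \<alpha>\<bar> \<le> 16 * d / R"
proof -
  define p r where "p = a * cos \<alpha> + b * sin \<alpha>" and "r = b * cos \<alpha> - a * sin \<alpha>"
  define \<tau> where "\<tau> = Arg (Complex p r)"
  have sc: "cos \<alpha> * cos \<alpha> = 1 - sin \<alpha> * sin \<alpha>"
    using sin_cos_squared_add[of \<alpha>] by (simp add: power2_eq_square)
  have a: "a = p * cos \<alpha> - r * sin \<alpha>" and b: "b = p * sin \<alpha> + r * cos \<alpha>"
    unfolding p_def r_def using sc by (algebra+)
  have nz': "p \<noteq> 0 \<or> r \<noteq> 0" using nz a b by auto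
  obtain S where S: "S > 0" "a = S * cos (\<alpha> + \<tau>)" "b = S * sin (\<alpha> + \<tau>)"
    using polar_rotation[OF nz', of \<alpha>] a b unfolding \<tau>_def by metis
  have m: "\<bar>(a - R * cos \<alpha>) * cos \<alpha>\<bar> \<le> d" "\<bar>(b - R * sin \<alpha>) * sin \<alpha>\<bar> \<le> d"
     "\<bar>(a - R * cos \<alpha>) * sin \<alpha>\<bar> \<le> d" "\<bar>(b - R * sin \<alpha>) * cos \<alpha>\<bar> \<le> d"
    using d by (auto simp: abs_mult intro!: order.trans[OF mult_right_le_one_le])
  have "p - R = (a - R * cos \<alpha>) * cos \<alpha> + (b - R * sin \<alpha>) * sin \<alpha>"
    unfolding p_def using sc by algebra
  moreover have "r = (b - R * sin \<alpha>) * cos \<alpha> - (a - R * cos \<alpha>) * sin \<alpha>"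
    unfolding r_def by (simp add: algebra_simps)
  ultimately have pr: "\<bar>p - R\<bar> \<le> 2 * d" "\<bar>r\<bar> \<le> 2 * d" using m by linarith+
  \<comment> \<open>For small \<open>d\<close> the rotated point stays in the right half plane; otherwise the trivial bound \<open>\<pi>\<close> is good enough.\<close>
  have "\<bar>\<tau>\<bar> \<le> 16 * d / R"
  proof (cases "4 * d \<le> R")
    case True
    then have p: "p \<ge> R / 2" using pr by linarith
    then have "\<tau> = arctan (r / p)" unfolding \<tau>_def using R by (subst arg_conv_arctan) auto
    then have "\<bar>\<tau>\<bar> \<le> \<bar>r / p\<bar>" using abs_arctan_le[of "r / p"] by simp
    also have "\<dots> \<le> 2 * d / (R / 2)"
      unfolding abs_divide using p pr R by (intro frac_le) auto
    also have "\<dots> \<le> 16 * d / R" using R d(1) by (simp add: divide_simps)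
    finally show ?thesis .
  next
    case False
    have "\<bar>\<tau>\<bar> \<le> pi" using Arg_bounded[of "Complex p r"] unfolding \<tau>_def by auto
    also have "pi \<le> 4" using pi_less_4 by simp
    also have "4 \<le> 16 * d / R" using False R by (simp add: le_divide_eq)
    finally show ?thesis .
  qed
  with S show ?thesis by (intro that[of S "\<alpha> + \<tau>"]) auto
qed

text \<open>Rescaling the second coordinate by \<open>\<rho> = C' / C\<close> turns the direction \<open>\<theta>\<close> by an angle with tangent
  \<open>(\<rho> - 1) sin \<theta> cos \<theta> / (cos\<^sup>2 \<theta> + \<rho> sin\<^sup>2 \<theta>)\<close>. By the inequality of the means this is at most
  \<open>\<bar>\<rho> - 1\<bar> / (2 sqrt \<rho>)\<close> in absolute value. The resulting constant \<open>1/2\<close> is what makes the full variation,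
  and not twice the variation, appear in the final bounds.\<close>

lemma angle_jump:
  fixes w v C C' R \<theta> :: real
  assumes C: "C > 0" "C' > 0" and R: "R > 0" and w: "w = R * cos \<theta>" and v: "C * v = R * sin \<theta>"
  obtains S \<phi> where "S > 0" "w = S * cos \<phi>" "C' * v = S * sin \<phi>" "\<bar>\<phi> - \<theta>\<bar> \<le> \<bar>ln C - ln C'\<bar> / 2"
proof -
  define \<rho> where "\<rho> = C' / C"
  have \<rho>: "\<rho> > 0" using C by (simp add: \<rho>_def)
  have v': "C' * v = \<rho> * (R * sin \<theta>)" using C unfolding v[symmetric] by (simp add: \<rho>_def)
  define p r where "p = R * ((cos \<theta>)\<^sup>2 + \<rho> * (sin \<theta>)\<^sup>2)" and "r = R * ((\<rho> - 1) * (sin \<theta> * cos \<theta>))"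
  define \<tau> where "\<tau> = Arg (Complex p r)"
  have sc: "(cos \<theta>)\<^sup>2 = 1 - (sin \<theta>)\<^sup>2" by (simp add: cos_squared_eq)
  have e: "w = p * cos \<theta> - r * sin \<theta>" "C' * v = p * sin \<theta> + r * cos \<theta>"
    unfolding p_def r_def w v' using sc by (algebra+)
  have pos: "(cos \<theta>)\<^sup>2 + \<rho> * (sin \<theta>)\<^sup>2 > 0"
  proof (cases "sin \<theta> = 0")
    case True
    then show ?thesis using sc by simp
  next
    case False
    then show ?thesis using \<rho> by (intro add_nonneg_pos) auto
  qed
  then have p: "p > 0" using R by (simp add: p_def)
  then have nz: "p \<noteq> 0 \<or> r \<noteq> 0" by simp
  obtain S where S: "S > 0" "w = S * cos (\<theta> + \<tau>)" "C' * v = S * sin (\<theta> + \<tau>)"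
    using polar_rotation[OF nz, of \<theta>] e unfolding \<tau>_def by metis
  have amgm: "2 * sqrt \<rho> * \<bar>sin \<theta> * cos \<theta>\<bar> \<le> (cos \<theta>)\<^sup>2 + \<rho> * (sin \<theta>)\<^sup>2"
    using sum_squares_bound[of "\<bar>cos \<theta>\<bar>" "sqrt \<rho> * \<bar>sin \<theta>\<bar>"] \<rho> by (simp add: power_mult_distrib abs_mult mult_ac)
  have "r / p = (\<rho> - 1) * (sin \<theta> * cos \<theta>) / ((cos \<theta>)\<^sup>2 + \<rho> * (sin \<theta>)\<^sup>2)"
    using R by (simp add: p_def r_def)
  then have "\<bar>r / p\<bar> = \<bar>\<rho> - 1\<bar> * \<bar>sin \<theta> * cos \<theta>\<bar> / ((cos \<theta>)\<^sup>2 + \<rho> * (sin \<theta>)\<^sup>2)"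
    using pos by (simp add: abs_mult abs_divide)
  also have "\<dots> \<le> \<bar>\<rho> - 1\<bar> / (2 * sqrt \<rho>)"
    using mult_left_mono[OF amgm, of "\<bar>\<rho> - 1\<bar>"] pos \<rho> by (simp add: divide_simps mult_ac)
  finally have le: "\<bar>r / p\<bar> \<le> \<bar>\<rho> - 1\<bar> / (2 * sqrt \<rho>)" .
  have "\<tau> = arctan (r / p)" unfolding \<tau>_def using p by (subst arg_conv_arctan) auto
  then have "\<bar>\<tau>\<bar> = arctan \<bar>r / p\<bar>" by (auto simp: abs_if arctan_minus)
  also have "\<dots> \<le> arctan (\<bar>\<rho> - 1\<bar> / (2 * sqrt \<rho>))" using le by (simp add: arctan_le_iff)
  also have "\<dots> \<le> \<bar>ln \<rho>\<bar> / 2" by (rule arctan_half_log[OF \<rho>])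
  also have "\<bar>ln \<rho>\<bar> = \<bar>ln C - ln C'\<bar>" using C by (simp add: \<rho>_def ln_div abs_minus_commute)
  finally show ?thesis using S by (intro that[of S "\<theta> + \<tau>"]) auto
qed

text \<open>For constant coefficient \<open>c\<close>, the vector \<open>(v', \<omega> c v)\<close> rotates with angular velocity \<open>\<omega> c\<close>. Rotating
  back, that is, multiplying \<open>v' + i \<omega> c v\<close> by \<open>exp (- i \<omega> c x)\<close>, leaves the derivative
  \<open>\<omega>\<^sup>2 (c\<^sup>2 - s\<^sup>2) v exp (- i \<omega> c x)\<close>. The two estimates are its real and imaginary part.\<close>

lemma rotated_flow_estimate:
  fixes s v w :: "real \<Rightarrow> real"
  assumes s: "bdd_meas01 s" and sb: "\<And>x. x \<in> {0..1} \<Longrightarrow> 0 \<le> s x \<and> s x \<le> smax"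
    and sol: "sl_solution (\<lambda>x. (s x)\<^sup>2) (\<omega>\<^sup>2) v w"
    and vb: "\<And>x. x \<in> {0..1} \<Longrightarrow> \<bar>v x\<bar> \<le> B"
    and c: "0 \<le> c" "c \<le> smax" and xy: "0 \<le> x" "x \<le> y" "y \<le> 1"
  defines "\<delta> \<equiv> 2 * \<omega>\<^sup>2 * smax * B * integral {x..y} (\<lambda>t. \<bar>s t - c\<bar>)"
  shows "\<bar>(w y * cos (\<omega> * c * y) + \<omega> * c * v y * sin (\<omega> * c * y))
        - (w x * cos (\<omega> * c * x) + \<omega> * c * v x * sin (\<omega> * c * x))\<bar> \<le> \<delta>"
    and "\<bar>(\<omega> * c * v y * cos (\<omega> * c * y) - w y * sin (\<omega> * c * y))
        - (\<omega> * c * v x * cos (\<omega> * c * x) - w x * sin (\<omega> * c * x))\<bar> \<le> \<delta>"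
proof -
  define C where "C = \<omega> * c"
  have q: "bdd_meas01 (\<lambda>x. (s x)\<^sup>2)" unfolding power2_eq_square by (intro bdd_meas01_mult s)
  note cont = sl_solution_continuous[OF q sol]
  note bv = cont(1)[THEN bdd_meas01_continuous] and bw = cont(2)[THEN bdd_meas01_continuous]
  let ?f = "\<lambda>t. - \<omega>\<^sup>2 * ((s t)\<^sup>2 * v t)"
  have f: "bdd_meas01 ?f" by (intro bdd_meas01_mult bdd_meas01_const q bv)
  have w: "w t = w 0 + integral {0..t} ?f" if "t \<in> {0..1}" for t
    using sl_solutionD(2)[OF sol that] by simp
  have v: "v t = v 0 + integral {0..t} w" if t: "t \<in> {0..1}" for t
  proof -
    have "(w has_integral v t - v 0) {0..t}"
    proof (rule fundamental_theorem_of_calculus)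
      fix r assume r: "r \<in> {0..t}"
      with t have "(v has_real_derivative w r) (at r within {0..t})"
        by (intro DERIV_subset[OF sl_solutionD(1)[OF sol, of r]]) auto
      then show "(v has_vector_derivative w r) (at r within {0..t})"
        by (simp add: has_real_derivative_iff_has_vector_derivative)
    qed (use t in auto)
    then show ?thesis by (simp add: integral_unique)
  qed
  have trig: "continuous_on {0..1} (\<lambda>t. a * cos (C * t))" "continuous_on {0..1} (\<lambda>t. a * sin (C * t))" for a :: real
    by (intro continuous_intros)+
  note bt = trig[THEN bdd_meas01_continuous]
  have btc: "bdd_meas01 (\<lambda>t. cos (C * t))" "bdd_meas01 (\<lambda>t. sin (C * t))"
    using bt(1)[of 1] bt(2)[of 1] by simp_all
  have dcos: "((\<lambda>t. a * cos (C * t)) has_real_derivative (- a * C) * sin (C * t)) (at t within {0..1})" for t a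
    by (auto intro!: derivative_eq_intros)
  have dsin: "((\<lambda>t. a * sin (C * t)) has_real_derivative (a * C) * cos (C * t)) (at t within {0..1})" for t a
    by (auto intro!: derivative_eq_intros)
  have parts:
    "a * cos (C * y) * w y - a * cos (C * x) * w x
       = integral {x..y} (\<lambda>t. (- a * C) * sin (C * t) * w t + a * cos (C * t) * ?f t)"
    "a * sin (C * y) * w y - a * sin (C * x) * w x
       = integral {x..y} (\<lambda>t. (a * C) * cos (C * t) * w t + a * sin (C * t) * ?f t)"
    "a * cos (C * y) * v y - a * cos (C * x) * v x
       = integral {x..y} (\<lambda>t. (- a * C) * sin (C * t) * v t + a * cos (C * t) * w t)"
    "a * sin (C * y) * v y - a * sin (C * x) * v x
       = integral {x..y} (\<lambda>t. (a * C) * cos (C * t) * v t + a * sin (C * t) * w t)" for a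
    by (rule integral_by_parts_bounded[OF dcos trig(2) f w xy] integral_by_parts_bounded[OF dsin trig(1) f w xy]
      integral_by_parts_bounded[OF dcos trig(2) bw v xy] integral_by_parts_bounded[OF dsin trig(1) bw v xy]; assumption)+
  let ?g = "\<lambda>t. ?f t + C\<^sup>2 * v t"
  have bg: "bdd_meas01 ?g" by (intro bdd_meas01_add bdd_meas01_mult bdd_meas01_const f bv)
  \<comment> \<open>The terms with \<open>w sin\<close> cancel: this is the effect of rotating with the right speed.\<close>
  have A: "(w y * cos (C * y) + C * v y * sin (C * y)) - (w x * cos (C * x) + C * v x * sin (C * x))
      = integral {x..y} (\<lambda>t. ?g t * cos (C * t))"
  proof -
    have "(w y * cos (C * y) + C * v y * sin (C * y)) - (w x * cos (C * x) + C * v x * sin (C * x))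
      = (1 * cos (C * y) * w y - 1 * cos (C * x) * w x) + (C * sin (C * y) * v y - C * sin (C * x) * v x)"
      by simp
    also have "\<dots> = integral {x..y} (\<lambda>t. ((- 1 * C) * sin (C * t) * w t + 1 * cos (C * t) * ?f t)
          + ((C * C) * cos (C * t) * v t + C * sin (C * t) * w t))"
      unfolding parts(1)[of 1] parts(4)[of C] using xy
      by (intro Henstock_Kurzweil_Integration.integral_add[symmetric] bdd_meas01_integrable_on bdd_meas01_add
          bdd_meas01_mult[OF _ bw] bdd_meas01_mult[OF _ f] bdd_meas01_mult[OF _ bv] bt) auto
    also have "\<dots> = integral {x..y} (\<lambda>t. ?g t * cos (C * t))"
      by (simp add: algebra_simps power2_eq_square)
    finally show ?thesis .
  qed
  have Bq: "(C * v y * cos (C * y) - w y * sin (C * y)) - (C * v x * cos (C * x) - w x * sin (C * x))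
      = integral {x..y} (\<lambda>t. ?g t * (- sin (C * t)))"
  proof -
    have "(C * v y * cos (C * y) - w y * sin (C * y)) - (C * v x * cos (C * x) - w x * sin (C * x))
      = (C * cos (C * y) * v y - C * cos (C * x) * v x) + ((-1) * sin (C * y) * w y - (-1) * sin (C * x) * w x)"
      by simp
    also have "\<dots> = integral {x..y} (\<lambda>t. ((- C * C) * sin (C * t) * v t + C * cos (C * t) * w t)
          + ((-1 * C) * cos (C * t) * w t + (-1) * sin (C * t) * ?f t))"
      unfolding parts(2)[of "-1"] parts(3)[of C] using xy
      by (intro Henstock_Kurzweil_Integration.integral_add[symmetric] bdd_meas01_integrable_on bdd_meas01_add
          bdd_meas01_mult[OF _ bw] bdd_meas01_mult[OF _ f] bdd_meas01_mult[OF _ bv] bt) auto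
    also have "\<dots> = integral {x..y} (\<lambda>t. ?g t * (- sin (C * t)))"
      by (simp add: algebra_simps power2_eq_square)
    finally show ?thesis .
  qed
  have gb: "\<bar>?g t\<bar> \<le> 2 * \<omega>\<^sup>2 * smax * B * \<bar>s t - c\<bar>" if t: "t \<in> {x..y}" for t
  proof -
    have t01: "t \<in> {0..1}" using t xy by auto
    have "?g t = - (\<omega>\<^sup>2 * ((s t + c) * v t) * (s t - c))"
      by (simp add: C_def power2_eq_square algebra_simps)
    then have "\<bar>?g t\<bar> = \<omega>\<^sup>2 * (\<bar>s t + c\<bar> * \<bar>v t\<bar>) * \<bar>s t - c\<bar>" by (simp add: abs_mult)
    also have "\<dots> \<le> \<omega>\<^sup>2 * ((2 * smax) * B) * \<bar>s t - c\<bar>"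
      using sb[OF t01] vb[OF t01] c by (intro mult_right_mono mult_left_mono mult_mono) auto
    finally show ?thesis by (simp add: mult_ac)
  qed
  have bound: "\<bar>integral {x..y} (\<lambda>t. ?g t * h t)\<bar> \<le> \<delta>"
    if h: "bdd_meas01 h" "\<And>t. \<bar>h t\<bar> \<le> 1" for h
  proof -
    have "norm (integral {x..y} (\<lambda>t. ?g t * h t)) \<le> integral {x..y} (\<lambda>t. 2 * \<omega>\<^sup>2 * smax * B * \<bar>s t - c\<bar>)"
    proof (rule Henstock_Kurzweil_Integration.integral_norm_bound_integral)
      fix t assume t: "t \<in> {x..y}"
      have "\<bar>?g t\<bar> * \<bar>h t\<bar> \<le> \<bar>?g t\<bar>" using h(2)[of t] by (intro mult_right_le_one_le) auto
      with gb[OF t] show "norm (?g t * h t) \<le> 2 * \<omega>\<^sup>2 * smax * B * \<bar>s t - c\<bar>"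
        unfolding real_norm_def abs_mult[of "?g t" "h t"] by linarith
    next
      show "(\<lambda>t. ?g t * h t) integrable_on {x..y}"
        using xy by (intro bdd_meas01_integrable_on bdd_meas01_mult[OF bg h(1)]) auto
      have "bdd_meas01 (\<lambda>t. 2 * \<omega>\<^sup>2 * smax * B * \<bar>s t - c\<bar>)"
        by (intro bdd_meas01_mult bdd_meas01_const bdd_meas01_abs bdd_meas01_diff s)
      then show "(\<lambda>t. 2 * \<omega>\<^sup>2 * smax * B * \<bar>s t - c\<bar>) integrable_on {x..y}"
        using xy by (intro bdd_meas01_integrable_on) auto
    qed
    then show ?thesis by (simp add: \<delta>_def)
  qed
  show "\<bar>(w y * cos (\<omega> * c * y) + \<omega> * c * v y * sin (\<omega> * c * y))
        - (w x * cos (\<omega> * c * x) + \<omega> * c * v x * sin (\<omega> * c * x))\<bar> \<le> \<delta>"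
    unfolding C_def[symmetric] A by (rule bound[OF btc(1)]) simp
  show "\<bar>(\<omega> * c * v y * cos (\<omega> * c * y) - w y * sin (\<omega> * c * y))
        - (\<omega> * c * v x * cos (\<omega> * c * x) - w x * sin (\<omega> * c * x))\<bar> \<le> \<delta>"
    unfolding C_def[symmetric] Bq by (rule bound[OF bdd_meas01_minus[OF btc(2)]]) simp
qed

text \<open>The lower bound \<open>m\<close> for the radius converts the displacement of the rotated vector into a
  displacement of its angle.\<close>

lemma angle_flow:
  fixes s v w :: "real \<Rightarrow> real"
  assumes s: "bdd_meas01 s" and sb: "\<And>x. x \<in> {0..1} \<Longrightarrow> 0 \<le> s x \<and> s x \<le> smax"
    and sol: "sl_solution (\<lambda>x. (s x)\<^sup>2) (\<omega>\<^sup>2) v w"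
    and vb: "\<And>x. x \<in> {0..1} \<Longrightarrow> \<bar>v x\<bar> \<le> B"
    and c: "0 \<le> c" "c \<le> smax" and xy: "0 \<le> x" "x \<le> y" "y \<le> 1"
    and nz: "w y \<noteq> 0 \<or> \<omega> * c * v y \<noteq> 0"
    and R: "0 < m" "m \<le> R" and pol: "w x = R * cos \<theta>" "\<omega> * c * v x = R * sin \<theta>"
  obtains S \<phi> where "S > 0" "w y = S * cos \<phi>" "\<omega> * c * v y = S * sin \<phi>"
     "\<bar>\<phi> - \<theta> - \<omega> * c * (y - x)\<bar> \<le> 32 * \<omega>\<^sup>2 * smax * B / m * integral {x..y} (\<lambda>t. \<bar>s t - c\<bar>)"
proof -
  define C where "C = \<omega> * c"
  define I where "I = integral {x..y} (\<lambda>t. \<bar>s t - c\<bar>)"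
  define d where "d = 2 * \<omega>\<^sup>2 * smax * B * I"
  define a where "a = w y * cos (C * y) + C * v y * sin (C * y)"
  define b where "b = C * v y * cos (C * y) - w y * sin (C * y)"
  have ax: "w x * cos (C * x) + C * v x * sin (C * x) = R * cos (\<theta> - C * x)"
    "C * v x * cos (C * x) - w x * sin (C * x) = R * sin (\<theta> - C * x)"
    using pol unfolding C_def by (simp_all add: cos_diff sin_diff algebra_simps)
  have d: "\<bar>a - R * cos (\<theta> - C * x)\<bar> \<le> d" "\<bar>b - R * sin (\<theta> - C * x)\<bar> \<le> d"
    unfolding ax[symmetric] a_def b_def d_def I_def
    by (rule rotated_flow_estimate[OF s sb sol vb c xy, folded C_def]; assumption)+
  have sc: "cos (C * y) * cos (C * y) = 1 - sin (C * y) * sin (C * y)"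
    using sin_cos_squared_add[of "C * y"] by (simp add: power2_eq_square)
  have w: "w y = a * cos (C * y) - b * sin (C * y)" and v: "C * v y = a * sin (C * y) + b * cos (C * y)"
    unfolding a_def b_def using sc by algebra+
  have ab: "a \<noteq> 0 \<or> b \<noteq> 0" using nz w v by (auto simp: C_def)
  have R0: "R > 0" using R by simp
  obtain \<beta> S where S: "S > 0" "a = S * cos \<beta>" "b = S * sin \<beta>" and \<beta>: "\<bar>\<beta> - (\<theta> - C * x)\<bar> \<le> 16 * d / R"
    by (rule angle_perturbation[OF R0 ab d])
  have "0 \<le> d" using d(1) by linarith
  then have "16 * d / R \<le> 16 * d / m" using R by (intro divide_left_mono) auto
  also have "\<dots> = 32 * \<omega>\<^sup>2 * smax * B / m * I" by (simp add: d_def)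
  finally have "\<bar>(\<beta> + C * y) - \<theta> - C * (y - x)\<bar> \<le> 32 * \<omega>\<^sup>2 * smax * B / m * I"
    using \<beta> by (simp add: algebra_simps)
  moreover have "w y = S * cos (\<beta> + C * y)" "C * v y = S * sin (\<beta> + C * y)"
    unfolding w v S by (simp_all add: cos_add sin_add algebra_simps)
  ultimately show ?thesis using S(1) unfolding C_def I_def by (intro that[of S "\<beta> + \<omega> * c * y"]) auto
qed

text \<open>Alternates \<open>angle_flow\<close> on the intervals of the grid with \<open>angle_jump\<close> at the interior grid
  points. The bound \<open>m\<close> is stated with the smallest admissible constant \<open>smin\<close>, so that \<open>K\<close> does
  not depend on the grid or on the constants \<open>c i\<close>.\<close>

lemma angle_along_steps:
  fixes s v w :: "real \<Rightarrow> real" and c :: "nat \<Rightarrow> real"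
  assumes s: "bdd_meas01 s" and sb: "\<And>x. x \<in> {0..1} \<Longrightarrow> 0 \<le> s x \<and> s x \<le> smax"
    and \<omega>: "\<omega> > 0" and sol: "sl_solution (\<lambda>x. (s x)\<^sup>2) (\<omega>\<^sup>2) v w"
    and vb: "\<And>x. x \<in> {0..1} \<Longrightarrow> \<bar>v x\<bar> \<le> B"
    and m: "0 < m" "\<And>x. x \<in> {0..1} \<Longrightarrow> m\<^sup>2 \<le> (w x)\<^sup>2 + (\<omega> * smin * v x)\<^sup>2"
    and smin: "0 < smin" and n: "n > 0" and c: "\<And>i. i < n \<Longrightarrow> smin \<le> c i \<and> c i \<le> smax"
    and start: "R0 > 0" "w 0 = R0 * cos \<theta>0" "\<omega> * c 0 * v 0 = R0 * sin \<theta>0"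
  defines "K \<equiv> 32 * \<omega>\<^sup>2 * smax * B / m"
    and "err \<equiv> (\<lambda>i. integral {real i / n..real (Suc i) / n} (\<lambda>t. \<bar>s t - c i\<bar>))"
  obtains S \<phi> where "S > 0" "w 1 = S * cos \<phi>" "\<omega> * c (n - 1) * v 1 = S * sin \<phi>"
    "\<bar>\<phi> - \<theta>0 - \<omega> * (\<Sum>i<n. c i / n)\<bar>
       \<le> (\<Sum>i<n - 1. \<bar>ln (c i) - ln (c (Suc i))\<bar>) / 2 + K * (\<Sum>i<n. err i)"
proof -
  have polar_ge: "m \<le> R" if "R > 0" "i < n" "x \<in> {0..1}" "w x = R * cos \<theta>" "\<omega> * c i * v x = R * sin \<theta>" for R i x \<theta>
  proof -
    have le: "(\<omega> * smin * v x)\<^sup>2 \<le> (\<omega> * c i * v x)\<^sup>2"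
      unfolding power_mult_distrib using c[OF that(2)] smin \<omega>
      by (intro mult_right_mono mult_left_mono power_mono) auto
    have "m\<^sup>2 \<le> (w x)\<^sup>2 + (\<omega> * smin * v x)\<^sup>2" by (rule m(2)[OF that(3)])
    also have "\<dots> \<le> (w x)\<^sup>2 + (\<omega> * c i * v x)\<^sup>2" using le by simp
    also have "\<dots> = R\<^sup>2 * ((cos \<theta>)\<^sup>2 + (sin \<theta>)\<^sup>2)"
      unfolding that(4,5) power_mult_distrib distrib_left ..
    also have "\<dots> = R\<^sup>2" by (simp only: sin_cos_squared_add2 mult_1_right)
    finally show ?thesis by (rule power2_le_imp_le) (rule less_imp_le[OF that(1)])
  qed
  have flow: "\<exists>S \<phi>. S > 0 \<and> w (real (Suc i) / n) = S * cos \<phi> \<and> \<omega> * c i * v (real (Suc i) / n) = S * sin \<phi> \<and>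
      \<bar>\<phi> - \<theta> - \<omega> * c i / n\<bar> \<le> K * err i"
    if i: "i < n" and R: "R > 0" "w (real i / n) = R * cos \<theta>" "\<omega> * c i * v (real i / n) = R * sin \<theta>" for i R \<theta>
  proof -
    let ?x = "real i / n" and ?y = "real (Suc i) / n"
    have xy: "0 \<le> ?x" "?x \<le> ?y" "?y \<le> 1"
      using i by (simp_all add: divide_right_mono del: of_nat_Suc)
    have ci: "0 \<le> c i" "c i \<le> smax" "c i > 0" using c[OF i] smin by auto
    have y01: "?y \<in> {0..1}" using xy by auto
    have "m\<^sup>2 > 0" using m(1) by simp
    then have "0 < (w ?y)\<^sup>2 + (\<omega> * smin * v ?y)\<^sup>2" using m(2)[OF y01] by linarith
    then have nz: "w ?y \<noteq> 0 \<or> \<omega> * c i * v ?y \<noteq> 0" using \<omega> ci by auto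
    have mR: "m \<le> R" by (rule polar_ge[OF R(1) i _ R(2,3)]) (use xy in auto)
    have step: "\<omega> * c i * (?y - ?x) = \<omega> * c i / n" using n by (simp add: field_simps)
    obtain S \<phi> where "S > 0" "w ?y = S * cos \<phi>" "\<omega> * c i * v ?y = S * sin \<phi>"
       "\<bar>\<phi> - \<theta> - \<omega> * c i * (?y - ?x)\<bar> \<le> 32 * \<omega>\<^sup>2 * smax * B / m * integral {?x..?y} (\<lambda>t. \<bar>s t - c i\<bar>)"
      by (rule angle_flow[OF s sb sol vb ci(1,2) xy nz m(1) mR R(2,3)])
    then show ?thesis unfolding step K_def err_def by blast
  qed
  have ind: "\<exists>R \<theta>. R > 0 \<and> w (real i / n) = R * cos \<theta> \<and> \<omega> * c i * v (real i / n) = R * sin \<theta> \<and>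
      \<bar>\<theta> - \<theta>0 - \<omega> * (\<Sum>j<i. c j / n)\<bar> \<le> (\<Sum>j<i. \<bar>ln (c j) - ln (c (Suc j))\<bar>) / 2 + K * (\<Sum>j<i. err j)"
    if "i < n" for i
    using that
  proof (induction i)
    case 0
    then show ?case using start by (intro exI[of _ R0] exI[of _ \<theta>0]) simp
  next
    case (Suc i)
    then have i: "i < n" by simp
    from Suc.IH[OF i] obtain R \<theta> where R: "R > 0" "w (real i / n) = R * cos \<theta>" "\<omega> * c i * v (real i / n) = R * sin \<theta>"
      and \<theta>: "\<bar>\<theta> - \<theta>0 - \<omega> * (\<Sum>j<i. c j / n)\<bar> \<le> (\<Sum>j<i. \<bar>ln (c j) - ln (c (Suc j))\<bar>) / 2 + K * (\<Sum>j<i. err j)"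
      by blast
    from flow[OF i R] obtain S \<phi> where S: "S > 0" "w (real (Suc i) / n) = S * cos \<phi>" "\<omega> * c i * v (real (Suc i) / n) = S * sin \<phi>"
      and \<phi>: "\<bar>\<phi> - \<theta> - \<omega> * c i / n\<bar> \<le> K * err i" by blast
    have cc: "\<omega> * c i > 0" "\<omega> * c (Suc i) > 0" using c[OF i] c[OF Suc.prems] smin \<omega> by auto
    obtain T \<psi> where T: "T > 0" "w (real (Suc i) / n) = T * cos \<psi>" "\<omega> * c (Suc i) * v (real (Suc i) / n) = T * sin \<psi>"
      and \<psi>: "\<bar>\<psi> - \<phi>\<bar> \<le> \<bar>ln (\<omega> * c i) - ln (\<omega> * c (Suc i))\<bar> / 2"
      by (rule angle_jump[OF cc S])
    have "ln (\<omega> * c i) - ln (\<omega> * c (Suc i)) = ln (c i) - ln (c (Suc i))"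
      using c[OF i] c[OF Suc.prems] smin \<omega> by (simp add: ln_mult_pos)
    with \<psi> have \<psi>: "\<bar>\<psi> - \<phi>\<bar> \<le> \<bar>ln (c i) - ln (c (Suc i))\<bar> / 2" by simp
    have "\<omega> * (c i / n) = \<omega> * c i / n" by simp
    with \<theta> \<phi> \<psi> have "\<bar>\<psi> - \<theta>0 - \<omega> * (\<Sum>j<Suc i. c j / n)\<bar>
        \<le> (\<Sum>j<Suc i. \<bar>ln (c j) - ln (c (Suc j))\<bar>) / 2 + K * (\<Sum>j<Suc i. err j)"
      unfolding sum.lessThan_Suc distrib_left add_divide_distrib by linarith
    with T show ?case by blast
  qed
  have n1: "n - 1 < n" "Suc (n - 1) = n" using n by auto
  from ind[OF n1(1)] obtain R \<theta> where R: "R > 0" "w (real (n - 1) / n) = R * cos \<theta>" "\<omega> * c (n - 1) * v (real (n - 1) / n) = R * sin \<theta>"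
      and \<theta>: "\<bar>\<theta> - \<theta>0 - \<omega> * (\<Sum>j<n - 1. c j / n)\<bar> \<le> (\<Sum>j<n - 1. \<bar>ln (c j) - ln (c (Suc j))\<bar>) / 2 + K * (\<Sum>j<n - 1. err j)"
      by blast
  from flow[OF n1(1) R] n obtain S \<phi> where S: "S > 0" "w 1 = S * cos \<phi>" "\<omega> * c (n - 1) * v 1 = S * sin \<phi>"
      and \<phi>: "\<bar>\<phi> - \<theta> - \<omega> * c (n - 1) / n\<bar> \<le> K * err (n - 1)" unfolding n1(2) by auto
  have sums: "(\<Sum>j<n. f j) = (\<Sum>j<n - 1. f j) + f (n - 1)" for f :: "nat \<Rightarrow> real"
    using sum.lessThan_Suc[of f "n - 1"] n1(2) by simp
  have "\<bar>\<phi> - \<theta>0 - \<omega> * (\<Sum>i<n. c i / n)\<bar>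
       \<le> (\<Sum>i<n - 1. \<bar>ln (c i) - ln (c (Suc i))\<bar>) / 2 + K * (\<Sum>i<n. err i)"
  proof -
    have "\<omega> * (c (n - 1) / n) = \<omega> * c (n - 1) / n" by simp
    with \<theta> \<phi> show ?thesis unfolding sums distrib_left by linarith
  qed
  with S show ?thesis by (rule that)
qed

text \<open>A representative \<open>s\<close> of the coefficient that is bounded at every point. The null set \<open>N\<close> collects the
  points at which the coefficient must not be sampled; off \<open>N\<close>, sampled variations of \<open>ln s\<close> are
  bounded by \<open>V\<close>.\<close>

locale sl_speed =
  fixes s :: "real \<Rightarrow> real" and smin smax V :: real and N :: "real set"
  assumes s_meas: "bdd_meas01 s"
    and smin: "0 < smin" and s_bounds: "\<And>x. x \<in> {0..1} \<Longrightarrow> smin \<le> s x \<and> s x \<le> smax"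
    and N: "negligible N" and V: "0 \<le> V" "V < pi"
    and variation: "\<And>n t. \<lbrakk>\<And>i. i \<le> n \<Longrightarrow> t i \<in> {0..1} - N; \<And>i. i < n \<Longrightarrow> t i < t (Suc i)\<rbrakk>
        \<Longrightarrow> (\<Sum>i<n. \<bar>ln (s (t i)) - ln (s (t (Suc i)))\<bar>) \<le> V"
begin

definition q :: "real \<Rightarrow> real" where "q x = (s x)\<^sup>2"

text \<open>The travel time across the interval, if \<open>s\<close> is read as the reciprocal of a wave speed.\<close>

definition L :: real where "L = integral {0..1} s"

lemma q_meas: "bdd_meas01 q"
  unfolding q_def[abs_def] power2_eq_square by (intro bdd_meas01_mult s_meas)

lemma L_pos: "L > 0"
proof -
  have "smin = integral {0..1::real} (\<lambda>x. smin)" by simp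
  also have "\<dots> \<le> L" unfolding L_def
    using s_bounds by (intro integral_le bdd_meas01_integrable_on bdd_meas01_const s_meas) auto
  finally show ?thesis using smin by simp
qed

text \<open>Both error sources, the comparison with constant coefficients and the replacement of \<open>L\<close> by a
  Riemann sum of the samples, are multiples of the \<open>L\<^sup>1\<close>-distance of \<open>s\<close> to the step function.
  The scaling \<open>C\<close> of one coordinate at the right end point is positive and hence preserves the
  quadrant in which the vector lies.\<close>

lemma phase_estimate:
  assumes \<omega>: "\<omega> > 0" and sol: "sl_solution q (\<omega>\<^sup>2) v w"
    and nz: "\<And>x. x \<in> {0..1} \<Longrightarrow> v x \<noteq> 0 \<or> w x \<noteq> 0"
    and start: "\<And>C. C > 0 \<Longrightarrow> \<exists>R>0. w 0 = R * cos \<theta> \<and> C * v 0 = R * sin \<theta>" and e: "e > 0"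
  obtains R C \<phi> where "R > 0" "C > 0" "w 1 = R * cos \<phi>" "C * v 1 = R * sin \<phi>" "\<bar>\<phi> - \<theta> - \<omega> * L\<bar> \<le> V / 2 + e"
proof -
  note cont = sl_solution_continuous[OF q_meas sol]
  obtain B where B: "B > 0" "\<And>x. x \<in> {0..1} \<Longrightarrow> \<bar>v x\<bar> \<le> B"
    using bdd_meas01_bound[OF bdd_meas01_continuous[OF cont(1)]] by blast
  let ?r = "\<lambda>x. (w x)\<^sup>2 + (\<omega> * smin * v x)\<^sup>2"
  have "continuous_on {0..1} ?r" by (intro continuous_intros cont)
  then obtain x0 where x0: "x0 \<in> {0..1}" "\<And>x. x \<in> {0..1} \<Longrightarrow> ?r x0 \<le> ?r x"
    using continuous_attains_inf[of "{0..1::real}" ?r] by auto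
  \<comment> \<open>By compactness the vector stays away from the origin, uniformly in the constants between \<open>smin\<close> and \<open>smax\<close>.\<close>
  define m where "m = sqrt (?r x0)"
  have "?r x0 > 0" using nz[OF x0(1)] \<omega> smin by (auto simp: add_pos_nonneg add_nonneg_pos)
  then have m: "m > 0" "\<And>x. x \<in> {0..1} \<Longrightarrow> m\<^sup>2 \<le> ?r x" using x0(2) by (auto simp: m_def)
  define K where "K = 32 * \<omega>\<^sup>2 * smax * B / m"
  have smax: "smax > 0" using s_bounds[of 0] smin by auto
  have K: "K \<ge> 0" using smax B m by (simp add: K_def)
  \<comment> \<open>\<open>K * d\<close> pays for the comparison with constant coefficients, \<open>\<omega> * d\<close> for the Riemann sum.\<close>
  define d where "d = e / (K + \<omega>)"
  have d: "d > 0" "(K + \<omega>) * d = e" using e K \<omega> by (auto simp: d_def)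
  obtain n t where n: "n > 0" and t: "\<And>i. i < n \<Longrightarrow> t i \<in> {real i / n<..<real (Suc i) / n} - N"
    and step: "(\<Sum>i<n. integral {real i / n..real (Suc i) / n} (\<lambda>x. \<bar>s x - s (t i)\<bar>)) \<le> d"
    using step_function_approximation[OF s_meas N d(1)] by blast
  have t01: "t i \<in> {0..1} - N" if "i < n" for i
  proof -
    have "real (Suc i) / n \<le> 1" "0 \<le> real i / n" using that n by simp_all
    moreover have "real i / n < t i" "t i < real (Suc i) / n" "t i \<notin> N" using t[OF that] by auto
    ultimately have "0 \<le> t i" "t i \<le> 1" by linarith+
    with \<open>t i \<notin> N\<close> show ?thesis by simp
  qed
  define c where "c i = s (t i)" for i
  have c: "smin \<le> c i \<and> c i \<le> smax" if "i < n" for i using t01[OF that] s_bounds by (auto simp: c_def)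
  define err where "err i = integral {real i / n..real (Suc i) / n} (\<lambda>x. \<bar>s x - c i\<bar>)" for i
  have c0: "\<omega> * c 0 > 0" using c[OF n] smin \<omega> by simp
  from start[OF c0] obtain R0 where R0: "R0 > 0" "w 0 = R0 * cos \<theta>" "\<omega> * c 0 * v 0 = R0 * sin \<theta>" by blast
  have sb: "0 \<le> s x \<and> s x \<le> smax" if "x \<in> {0..1}" for x using s_bounds[OF that] smin by auto
  have sol': "sl_solution (\<lambda>x. (s x)\<^sup>2) (\<omega>\<^sup>2) v w" using sol unfolding q_def[abs_def] .
  obtain S \<phi> where S: "S > 0" "w 1 = S * cos \<phi>" "\<omega> * c (n - 1) * v 1 = S * sin \<phi>"
    and \<phi>: "\<bar>\<phi> - \<theta> - \<omega> * (\<Sum>i<n. c i / n)\<bar>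
       \<le> (\<Sum>i<n - 1. \<bar>ln (c i) - ln (c (Suc i))\<bar>) / 2 + K * (\<Sum>i<n. err i)"
    unfolding K_def err_def
    by (rule angle_along_steps[where s = s and v = v and w = w and c = c, OF s_meas sb \<omega> sol' B(2) m smin n c R0])
  have var: "(\<Sum>i<n - 1. \<bar>ln (c i) - ln (c (Suc i))\<bar>) \<le> V"
    unfolding c_def
  proof (rule variation)
    show "t i \<in> {0..1} - N" if "i \<le> n - 1" for i using that n by (intro t01) auto
    show "t i < t (Suc i)" if "i < n - 1" for i
    proof -
      have "i < n" "Suc i < n" using that by linarith+
      then show ?thesis using t[of i] t[of "Suc i"] by (auto intro: less_trans simp del: of_nat_Suc)
    qed
  qed
  have "\<bar>(\<Sum>i<n. c i / n) - L\<bar> \<le> (\<Sum>i<n. err i)"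
  proof -
    have "L = (\<Sum>i<n. integral {real i / n..real (Suc i) / n} s)"
      unfolding L_def using sum_integral_grid[OF s_meas n order_refl] n by simp
    then have "\<bar>(\<Sum>i<n. c i / n) - L\<bar> = \<bar>\<Sum>i<n. (integral {real i / n..real (Suc i) / n} s - c i / n)\<bar>"
      by (simp add: sum_subtractf abs_minus_commute)
    also have "\<dots> \<le> (\<Sum>i<n. \<bar>integral {real i / n..real (Suc i) / n} s - c i / n\<bar>)" by (rule sum_abs)
    also have "\<dots> \<le> (\<Sum>i<n. err i)"
    proof (rule sum_mono)
      fix i assume "i \<in> {..<n}"
      then have xy: "0 \<le> real i / n" "real i / n \<le> real (Suc i) / n" "real (Suc i) / n \<le> 1"
        using n by (auto simp: divide_simps)
      have "real (Suc i) / n - real i / n = 1 / n" by (simp add: diff_divide_distrib[symmetric])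
      then have "integral {real i / n..real (Suc i) / n} s - c i / n
          = integral {real i / n..real (Suc i) / n} s - integral {real i / n..real (Suc i) / n} (\<lambda>x. c i)"
        using xy by simp
      also have "\<dots> = integral {real i / n..real (Suc i) / n} (\<lambda>x. s x - c i)"
        using xy by (intro Henstock_Kurzweil_Integration.integral_diff[symmetric] bdd_meas01_integrable_on
            bdd_meas01_const s_meas) auto
      also have "norm \<dots> \<le> err i"
        unfolding err_def using xy
        by (intro Henstock_Kurzweil_Integration.integral_norm_bound_integral bdd_meas01_integrable_on bdd_meas01_abs
            bdd_meas01_diff bdd_meas01_const s_meas) auto
      finally show "\<bar>integral {real i / n..real (Suc i) / n} s - c i / n\<bar> \<le> err i" by simp
    qed
    finally show ?thesis .
  qed
  moreover have errd: "(\<Sum>i<n. err i) \<le> d" using step unfolding err_def c_def .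
  ultimately have "\<omega> * \<bar>(\<Sum>i<n. c i / n) - L\<bar> \<le> \<omega> * d" using \<omega> by (intro mult_left_mono) auto
  then have 1: "\<bar>\<omega> * (\<Sum>i<n. c i / n) - \<omega> * L\<bar> \<le> \<omega> * d"
    using \<omega> by (simp add: right_diff_distrib[symmetric] abs_mult)
  have "K * (\<Sum>i<n. err i) \<le> K * d" using errd K by (rule mult_left_mono)
  with 1 \<phi> var d(2) have "\<bar>\<phi> - \<theta> - \<omega> * L\<bar> \<le> V / 2 + e" by (simp add: distrib_right)
  moreover have "\<omega> * c (n - 1) > 0" using c[of "n - 1"] n smin \<omega> by simp
  ultimately show ?thesis using S by (intro that[of S "\<omega> * c (n - 1)" \<phi>])
qed

end

section \<open>Eigenvalues as zeros of the shooting defect\<close>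

text \<open>The direction of \<open>(v', v)\<close> that the boundary condition prescribes; it allows both conditions to be
  treated together.\<close>

fun bc_angle :: "boundary_condition \<Rightarrow> real" where
  "bc_angle Dirichlet = 0" | "bc_angle Neumann = pi / 2"

lemma tendsto_integral_uniform_limit:
  assumes h: "bdd_meas01 h" and F: "\<And>\<mu>. continuous_on {0..1} (F \<mu>)" and f: "continuous_on {0..1} f"
    and lim: "uniform_limit {0..1} F f (at \<nu>)"
  shows "((\<lambda>\<mu>. integral {0..1} (\<lambda>x. h x * F \<mu> x)) \<longlongrightarrow> integral {0..1} (\<lambda>x. h x * f x)) (at \<nu>)"
proof (rule tendstoI)
  fix e :: real assume e: "e > 0"
  obtain M where M: "M > 0" "\<And>x. x \<in> {0..1} \<Longrightarrow> \<bar>h x\<bar> \<le> M" using bdd_meas01_bound[OF h] by blast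
  note bF = F[THEN bdd_meas01_continuous] and bf = f[THEN bdd_meas01_continuous]
  have "\<forall>\<^sub>F \<mu> in at \<nu>. \<forall>x\<in>{0..1}. dist (F \<mu> x) (f x) < e / (2 * M)"
    using lim M(1) e by (auto simp: uniform_limit_iff)
  then show "\<forall>\<^sub>F \<mu> in at \<nu>. dist (integral {0..1} (\<lambda>x. h x * F \<mu> x)) (integral {0..1} (\<lambda>x. h x * f x)) < e"
  proof eventually_elim
    case (elim \<mu>)
    have "integral {0..1} (\<lambda>x. h x * F \<mu> x) - integral {0..1} (\<lambda>x. h x * f x)
        = integral {0..1} (\<lambda>x. h x * F \<mu> x - h x * f x)"
      by (intro Henstock_Kurzweil_Integration.integral_diff[symmetric] bdd_meas01_integrable_on bdd_meas01_mult h bF bf) auto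
    also have "\<bar>\<dots>\<bar> \<le> M * (e / (2 * M)) * (1 - 0)"
    proof (rule integral_bound_bdd_meas01)
      fix x :: real assume x: "x \<in> {0..1}"
      have "\<bar>h x\<bar> * \<bar>F \<mu> x - f x\<bar> \<le> M * (e / (2 * M))"
        using elim x M(2)[OF x] M(1) by (intro mult_mono) (auto simp: dist_real_def intro: less_imp_le)
      then show "\<bar>h x * F \<mu> x - h x * f x\<bar> \<le> M * (e / (2 * M))"
        by (simp add: abs_mult[symmetric] right_diff_distrib)
    qed (auto intro!: bdd_meas01_diff bdd_meas01_mult h bF bf)
    also have "\<dots> < e" using M(1) e by simp
    finally show ?case by (simp add: dist_real_def)
  qed
qed

text \<open>After an upcrossing at \<open>a\<close> the function is positive; at the first later point where it fails to
  be positive it vanishes, but it arrives there from above.\<close>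

lemma not_only_upcrossings:
  fixes g :: "real \<Rightarrow> real"
  assumes ab: "a < b" and g: "continuous_on {a..b} g" and ends: "g a = 0" "g b = 0"
    and up: "\<And>z. \<lbrakk>z \<in> {a..b}; g z = 0\<rbrakk> \<Longrightarrow> \<forall>\<^sub>F x in at z. 0 < g x * (x - z)"
  shows False
proof -
  from up[of a] ab ends obtain d where d: "d > 0" "\<And>x. \<lbrakk>x \<noteq> a; \<bar>x - a\<bar> < d\<rbrakk> \<Longrightarrow> 0 < g x * (x - a)"
    by (auto simp: eventually_at dist_real_def)
  define a' where "a' = a + min d (b - a) / 2"
  have a': "a < a'" "a' < b" "\<bar>a' - a\<bar> < d" using d(1) ab by (auto simp: a'_def min_def field_simps)
  have "0 < g a' * (a' - a)" using a' by (intro d(2)) auto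
  with a' have ga': "g a' > 0" by (simp add: zero_less_mult_iff)
  let ?S = "{x \<in> {a'..b}. g x \<le> 0}"
  have cont: "continuous_on {a'..b} g" using a' by (intro continuous_on_subset[OF g]) auto
  have "closed ?S"
    by (rule continuous_on_closed_Collect_le[OF cont continuous_on_const]) auto
  moreover have "bounded ?S" by (rule bounded_subset[of "{a'..b}"]) auto
  ultimately have "compact ?S" by (simp add: compact_eq_bounded_closed)
  moreover have "b \<in> ?S" using a' ends by auto
  ultimately obtain z where z: "z \<in> ?S" "\<And>x. x \<in> ?S \<Longrightarrow> z \<le> x"
    using compact_attains_inf[of ?S] by auto
  have az: "a' < z" using z(1) ga' by (cases "z = a'") auto
  have "g z = 0"
  proof (rule ccontr)
    assume "g z \<noteq> 0"
    with z(1) have neg: "g z \<le> 0" "g z \<noteq> 0" by auto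
    have "continuous_on {a'..z} g" using z(1) by (intro continuous_on_subset[OF cont]) auto
    then obtain x where x: "a' \<le> x" "x \<le> z" "g x = 0"
      using IVT2'[of g z 0 a'] neg(1) ga' az by auto
    with z have "z \<le> x" by auto
    with x neg show False by simp
  qed
  with z(1) a' have "\<forall>\<^sub>F x in at z. 0 < g x * (x - z)" by (intro up) auto
  then obtain e where e: "e > 0" "\<And>x. \<lbrakk>x \<noteq> z; \<bar>x - z\<bar> < e\<rbrakk> \<Longrightarrow> 0 < g x * (x - z)"
    by (auto simp: eventually_at dist_real_def)
  define x where "x = z - min e (z - a') / 2"
  have x: "a' < x" "x < z" "\<bar>x - z\<bar> < e" using e(1) az by (auto simp: x_def min_def field_simps)
  have "0 < g x * (x - z)" using x by (intro e(2)) auto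
  with x have "g x < 0" by (simp add: zero_less_mult_iff)
  with x z have "z \<le> x" by auto
  with x show False by simp
qed

lemma int_multiple_pi:
  fixes k :: int
  shows "sin (of_int k * pi) = 0" "cos (of_int k * pi) * cos (of_int k * pi) = 1"
proof -
  show "sin (of_int k * pi) = 0" by (simp add: sin_zero_iff_int2)
  then show "cos (of_int k * pi) * cos (of_int k * pi) = 1"
    using sin_cos_squared_add[of "of_int k * pi"] by (simp add: power2_eq_square)
qed

lemma int_eq_if_near_pi:
  fixes j k :: int
  assumes "\<bar>of_int j * pi - of_int k * pi\<bar> < pi"
  shows "j = k"
proof -
  have "\<bar>of_int (j - k) * pi\<bar> < 1 * pi" using assms by (simp add: left_diff_distrib)
  then have "\<bar>real_of_int (j - k)\<bar> < 1" unfolding abs_mult by (simp add: mult_less_cancel_right)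
  then show ?thesis by linarith
qed

context sl_speed
begin

text \<open>The solution that starts in the direction prescribed by the boundary condition.\<close>

definition left_bc_sol :: "boundary_condition \<Rightarrow> real \<Rightarrow> real \<Rightarrow> real" where
  "left_bc_sol bc = shoot q (sin (bc_angle bc)) (cos (bc_angle bc))"

definition left_bc_deriv :: "boundary_condition \<Rightarrow> real \<Rightarrow> real \<Rightarrow> real" where
  "left_bc_deriv bc = shoot' q (sin (bc_angle bc)) (cos (bc_angle bc))"

text \<open>The component of \<open>(v', v)\<close> at \<open>1\<close> perpendicular to the prescribed direction; it vanishes exactly when
  the right boundary condition holds.\<close>

definition defect :: "boundary_condition \<Rightarrow> real \<Rightarrow> real" where
  "defect bc \<mu> = left_bc_sol bc \<mu> 1 * cos (bc_angle bc) - left_bc_deriv bc \<mu> 1 * sin (bc_angle bc)"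

text \<open>The component of \<open>(v', v)\<close> at \<open>1\<close> along the prescribed direction. At an eigenvalue its sign tells the
  parity of the number of half turns.\<close>

definition codefect :: "boundary_condition \<Rightarrow> real \<Rightarrow> real" where
  "codefect bc \<mu> = left_bc_sol bc \<mu> 1 * sin (bc_angle bc) + left_bc_deriv bc \<mu> 1 * cos (bc_angle bc)"

lemma left_bc_solution: "sl_solution q \<mu> (left_bc_sol bc \<mu>) (left_bc_deriv bc \<mu>)"
  and left_bc_at_0: "left_bc_sol bc \<mu> 0 = sin (bc_angle bc)" "left_bc_deriv bc \<mu> 0 = cos (bc_angle bc)"
  using shoot_solution[OF q_meas] by (simp_all add: left_bc_sol_def left_bc_deriv_def)

lemma continuous_left_bc_sol: "continuous_on {0..1} (left_bc_sol bc \<mu>)"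
  by (rule sl_solution_continuous[OF q_meas left_bc_solution])

text \<open>The Wronskian with the solution starting in the perpendicular direction is \<open>- 1\<close> everywhere.\<close>

lemma left_bc_sol_nonvanishing:
  assumes "x \<in> {0..1}"
  shows "left_bc_sol bc \<mu> x \<noteq> 0 \<or> left_bc_deriv bc \<mu> x \<noteq> 0"
proof -
  let ?a = "bc_angle bc"
  note z = shoot_solution[OF q_meas, where a = "cos ?a" and b = "- sin ?a" and \<mu> = \<mu>]
  have "(sin ?a)\<^sup>2 + (cos ?a)\<^sup>2 = 1" by simp
  then show ?thesis
    using lagrange_identity[OF q_meas left_bc_solution[of \<mu> bc] z(1) assms] by (auto simp: z left_bc_at_0 power2_eq_square)
qed

lemma defect_codefect_lagrange: "defect bc \<mu> * codefect bc \<nu> - codefect bc \<mu> * defect bc \<nu> = (\<mu> - \<nu>) * integral {0..1} (\<lambda>x. q x * left_bc_sol bc \<nu> x * left_bc_sol bc \<mu> x)"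
proof -
  let ?a = "bc_angle bc"
  have sc: "sin ?a * sin ?a + cos ?a * cos ?a = 1"
    using sin_cos_squared_add[of ?a] unfolding power2_eq_square .
  have "defect bc \<mu> * codefect bc \<nu> - codefect bc \<mu> * defect bc \<nu> = left_bc_sol bc \<mu> 1 * left_bc_deriv bc \<nu> 1 - left_bc_deriv bc \<mu> 1 * left_bc_sol bc \<nu> 1"
    unfolding defect_def codefect_def using sc by algebra
  also have "\<dots> = (\<mu> - \<nu>) * integral {0..1} (\<lambda>x. q x * left_bc_sol bc \<mu> x * left_bc_sol bc \<nu> x)"
    using lagrange_identity[OF q_meas left_bc_solution left_bc_solution, of 1 bc \<mu> bc \<nu>] by (simp add: left_bc_at_0)
  finally show ?thesis by (simp add: mult_ac)
qed

lemma uniform_limit_left_bc_sol: "uniform_limit {0..1} (left_bc_sol bc) (left_bc_sol bc \<nu>) (at \<nu>)"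
  unfolding left_bc_sol_def by (rule uniform_limit_shoot_parameter[OF q_meas])

lemma continuous_defect: "continuous_on A (defect bc)"
proof (rule continuous_at_imp_continuous_on, rule ballI)
  fix \<nu>
  have "((\<lambda>\<mu>. left_bc_sol bc \<mu> 1) \<longlongrightarrow> left_bc_sol bc \<nu> 1) (at \<nu>)"
    by (rule tendsto_uniform_limitI[OF uniform_limit_left_bc_sol]) simp
  moreover have "((\<lambda>\<mu>. left_bc_deriv bc \<mu> 1) \<longlongrightarrow> left_bc_deriv bc \<nu> 1) (at \<nu>)"
    unfolding left_bc_deriv_def shoot'_def
    by (fold left_bc_sol_def, intro tendsto_intros tendsto_integral_uniform_limit q_meas continuous_left_bc_sol uniform_limit_left_bc_sol)
  ultimately show "isCont (defect bc) \<nu>"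
    unfolding isCont_def defect_def by (intro tendsto_intros)
qed

text \<open>Otherwise the solution vanishes identically, hence so does its derivative,
  contradicting the nonzero initial direction.\<close>

lemma weighted_norm_pos: "integral {0..1} (\<lambda>x. q x * left_bc_sol bc \<nu> x * left_bc_sol bc \<nu> x) > 0"
proof -
  note meas = continuous_left_bc_sol[THEN bdd_meas01_continuous]
  have c2: "continuous_on {0..1} (\<lambda>x. (left_bc_sol bc \<nu> x)\<^sup>2)" by (intro continuous_intros continuous_left_bc_sol)
  have "smin\<^sup>2 * integral {0..1} (\<lambda>x. (left_bc_sol bc \<nu> x)\<^sup>2) = integral {0..1} (\<lambda>x. smin\<^sup>2 * (left_bc_sol bc \<nu> x)\<^sup>2)" by simp
  also have "\<dots> \<le> integral {0..1} (\<lambda>x. q x * left_bc_sol bc \<nu> x * left_bc_sol bc \<nu> x)"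
  proof (rule integral_le)
    show "smin\<^sup>2 * (left_bc_sol bc \<nu> x)\<^sup>2 \<le> q x * left_bc_sol bc \<nu> x * left_bc_sol bc \<nu> x" if "x \<in> {0..1}" for x
      using s_bounds[OF that] smin mult_right_mono[of "smin\<^sup>2" "(s x)\<^sup>2" "(left_bc_sol bc \<nu> x)\<^sup>2"]
      by (simp add: q_def power2_eq_square[of "left_bc_sol bc \<nu> x"] power_mono mult_ac)
    show "(\<lambda>x. q x * left_bc_sol bc \<nu> x * left_bc_sol bc \<nu> x) integrable_on {0..1}"
      by (intro bdd_meas01_integrable_on bdd_meas01_mult q_meas meas) auto
    show "(\<lambda>x. smin\<^sup>2 * (left_bc_sol bc \<nu> x)\<^sup>2) integrable_on {0..1}"
      by (intro integrable_continuous_real continuous_intros continuous_left_bc_sol)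
  qed
  finally have le: "smin\<^sup>2 * integral {0..1} (\<lambda>x. (left_bc_sol bc \<nu> x)\<^sup>2) \<le> integral {0..1} (\<lambda>x. q x * left_bc_sol bc \<nu> x * left_bc_sol bc \<nu> x)" .
  have "integral {0..1} (\<lambda>x. (left_bc_sol bc \<nu> x)\<^sup>2) \<noteq> 0"
  proof
    assume "integral {0..1} (\<lambda>x. (left_bc_sol bc \<nu> x)\<^sup>2) = 0"
    then have zero: "left_bc_sol bc \<nu> x = 0" if "x \<in> {0..1}" for x
      using integral_eq_0_iff[OF c2] that by auto
    have "integral {0..x} (\<lambda>t. q t * left_bc_sol bc \<nu> t) = 0" if "x \<in> {0..1}" for x
      using integral_cong[of "{0..x}" "\<lambda>t. q t * left_bc_sol bc \<nu> t" "\<lambda>t. 0"] that by (simp add: zero)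
    then have y': "left_bc_deriv bc \<nu> x = left_bc_deriv bc \<nu> 0" if "x \<in> {0..1}" for x
      using sl_solutionD(2)[OF left_bc_solution[of \<nu> bc] that] that by simp
    have "(left_bc_deriv bc \<nu> has_integral left_bc_sol bc \<nu> 1 - left_bc_sol bc \<nu> 0) {0..1}"
      using sl_solutionD(1)[OF left_bc_solution[of \<nu> bc]]
      by (intro fundamental_theorem_of_calculus) (auto simp: has_real_derivative_iff_has_vector_derivative)
    then have "integral {0..1} (left_bc_deriv bc \<nu>) = 0" by (simp add: zero integral_unique)
    moreover have "integral {0..1} (left_bc_deriv bc \<nu>) = integral {0..1} (\<lambda>x::real. left_bc_deriv bc \<nu> 0)"
      by (rule integral_cong) (rule y')
    ultimately have "left_bc_deriv bc \<nu> 0 = 0" by simp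
    with zero[of 0] left_bc_sol_nonvanishing[of 0 bc \<nu>] show False by simp
  qed
  moreover have "integral {0..1} (\<lambda>x. (left_bc_sol bc \<nu> x)\<^sup>2) \<ge> 0"
    by (rule Henstock_Kurzweil_Integration.integral_nonneg[OF integrable_continuous_real[OF c2]]) simp
  ultimately have "smin\<^sup>2 * integral {0..1} (\<lambda>x. (left_bc_sol bc \<nu> x)\<^sup>2) > 0" using smin by simp
  with le show ?thesis by linarith
qed

text \<open>At a zero \<open>\<nu>\<close> the Lagrange identity reads
  \<open>defect \<mu> * codefect \<nu> = (\<mu> - \<nu>) \<integral> q v\<^sub>\<nu> v\<^sub>\<mu>\<close>, and the integral tends to the positive weighted norm.\<close>

lemma defect_sign_near_zero:
  assumes "defect bc \<nu> = 0"
  shows "\<forall>\<^sub>F \<mu> in at \<nu>. 0 < defect bc \<mu> * codefect bc \<nu> * (\<mu> - \<nu>)"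
proof -
  have "((\<lambda>\<mu>. integral {0..1} (\<lambda>x. q x * left_bc_sol bc \<nu> x * left_bc_sol bc \<mu> x)) \<longlongrightarrow> integral {0..1} (\<lambda>x. q x * left_bc_sol bc \<nu> x * left_bc_sol bc \<nu> x)) (at \<nu>)"
    by (intro tendsto_integral_uniform_limit bdd_meas01_mult q_meas bdd_meas01_continuous[OF continuous_left_bc_sol]
        continuous_left_bc_sol uniform_limit_left_bc_sol)
  from order_tendstoD(1)[OF this weighted_norm_pos]
  have "\<forall>\<^sub>F \<mu> in at \<nu>. 0 < integral {0..1} (\<lambda>x. q x * left_bc_sol bc \<nu> x * left_bc_sol bc \<mu> x)" .
  moreover have "\<forall>\<^sub>F \<mu> in at \<nu>. \<mu> \<noteq> \<nu>" by (simp add: eventually_at_filter)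
  ultimately show ?thesis
  proof eventually_elim
    case (elim \<mu>)
    have "defect bc \<mu> * codefect bc \<nu> * (\<mu> - \<nu>) = integral {0..1} (\<lambda>x. q x * left_bc_sol bc \<nu> x * left_bc_sol bc \<mu> x) * (\<mu> - \<nu>)\<^sup>2"
      using defect_codefect_lagrange[of bc \<mu> \<nu>] assms by (simp add: power2_eq_square)
    then show ?case using elim by simp
  qed
qed

text \<open>Subtracting \<open>bc_angle\<close>, a multiple of a right angle, from the phase turns \<open>(v, v')\<close> into
  defect and codefect up to positive factors. The two factors differ because the scaling \<open>C\<close>
  acts on only one of the coordinates.\<close>

lemma phase_at_one:
  assumes "\<omega> > 0" "e > 0"
  obtains \<psi> P Q where "P > 0" "Q > 0" "defect bc (\<omega>\<^sup>2) = P * sin \<psi>" "codefect bc (\<omega>\<^sup>2) = Q * cos \<psi>" "\<bar>\<psi> - \<omega> * L\<bar> \<le> V / 2 + e"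
proof -
  let ?a = "bc_angle bc"
  have start: "\<exists>R>0. left_bc_deriv bc (\<omega>\<^sup>2) 0 = R * cos ?a \<and> C * left_bc_sol bc (\<omega>\<^sup>2) 0 = R * sin ?a" if "C > 0" for C
    using that by (cases bc) (auto simp: left_bc_at_0)
  obtain R C \<phi> where "R > 0" "C > 0" and w: "left_bc_deriv bc (\<omega>\<^sup>2) 1 = R * cos \<phi>" and v: "C * left_bc_sol bc (\<omega>\<^sup>2) 1 = R * sin \<phi>"
    and \<phi>: "\<bar>\<phi> - ?a - \<omega> * L\<bar> \<le> V / 2 + e"
    by (rule phase_estimate[OF assms(1) left_bc_solution left_bc_sol_nonvanishing start assms(2)])
  have v: "left_bc_sol bc (\<omega>\<^sup>2) 1 = R / C * sin \<phi>" using v \<open>C > 0\<close> by (simp add: field_simps)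
  have RC: "R / C > 0" using \<open>R > 0\<close> \<open>C > 0\<close> by simp
  show ?thesis
  proof (cases bc)
    case Dirichlet
    then show ?thesis
      using RC \<open>R > 0\<close> v w \<phi> by (intro that[of "R / C" R "\<phi> - ?a"]) (auto simp: defect_def codefect_def)
  next
    case Neumann
    then show ?thesis
      using RC \<open>R > 0\<close> v w \<phi> by (intro that[of R "R / C" "\<phi> - ?a"]) (auto simp: defect_def codefect_def sin_diff cos_diff)
  qed
qed

text \<open>The phase estimate holds for every positive error \<open>e\<close> but with a phase depending on \<open>e\<close>. At a zero of
  the defect the phase is a multiple of \<open>\<pi>\<close>, and as \<open>V < \<pi>\<close> all small \<open>e\<close> give the same multiple, so
  the error can be dropped. For \<open>\<omega> = 0\<close> solutions are affine: Dirichlet conditions exclude this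
  case, and the Neumann solution is the constant \<open>1\<close>, with \<open>k = 0\<close>.\<close>

lemma eigenphase:
  assumes "\<omega> \<ge> 0" "defect bc (\<omega>\<^sup>2) = 0"
  obtains k :: int where "\<bar>of_int k * pi - \<omega> * L\<bar> \<le> V / 2" "0 < codefect bc (\<omega>\<^sup>2) * cos (of_int k * pi)"
proof (cases "\<omega> = 0")
  case True
  have "left_bc_sol bc 0 1 = sin (bc_angle bc) + cos (bc_angle bc)" "left_bc_deriv bc 0 1 = cos (bc_angle bc)"
    using shoot_integral_equation[OF q_meas, of 1] by (simp_all add: left_bc_sol_def left_bc_deriv_def shoot'_def)
  with True assms V(1) show ?thesis
    by (cases bc) (auto simp: defect_def codefect_def intro!: that[of 0])
next
  case False
  with assms(1) have \<omega>: "\<omega> > 0" by simp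
  have near: "\<exists>k::int. \<bar>of_int k * pi - \<omega> * L\<bar> \<le> V / 2 + e \<and> 0 < codefect bc (\<omega>\<^sup>2) * cos (of_int k * pi)"
    if e: "e > 0" for e
  proof -
    obtain \<psi> P Q where *: "P > 0" "Q > 0" "defect bc (\<omega>\<^sup>2) = P * sin \<psi>" "codefect bc (\<omega>\<^sup>2) = Q * cos \<psi>" "\<bar>\<psi> - \<omega> * L\<bar> \<le> V / 2 + e"
      using phase_at_one[OF \<omega> e] by metis
    then have "sin \<psi> = 0" using assms(2) by simp
    then obtain k :: int where "\<psi> = of_int k * pi" by (auto simp: sin_zero_iff_int2)
    with * int_multiple_pi(2)[of k] show ?thesis by (intro exI[of _ k]) (simp add: mult.assoc)
  qed
  \<comment> \<open>Any error with \<open>V / 2 + e < \<pi> / 2\<close> identifies the integer.\<close>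
  have e0: "(pi - V) / 4 > 0" using V by simp
  have e1: "V / 2 + (pi - V) / 4 < pi / 2" using V by (simp add: field_simps)
  obtain k :: int where k: "\<bar>of_int k * pi - \<omega> * L\<bar> \<le> V / 2 + (pi - V) / 4" "0 < codefect bc (\<omega>\<^sup>2) * cos (of_int k * pi)"
    using near[OF e0] by blast
  have "\<bar>of_int k * pi - \<omega> * L\<bar> \<le> V / 2"
  proof (rule field_le_epsilon)
    fix e :: real assume e: "e > 0"
    with e0 have "min e ((pi - V) / 4) > 0" by simp
    from near[OF this] obtain j :: int where j: "\<bar>of_int j * pi - \<omega> * L\<bar> \<le> V / 2 + min e ((pi - V) / 4)" by blast
    have "j = k" using j k(1) e1 by (intro int_eq_if_near_pi) linarith
    with j show "\<bar>of_int k * pi - \<omega> * L\<bar> \<le> V / 2 + e" by simp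
  qed
  with k(2) show ?thesis by (rule that[rotated])
qed

text \<open>If \<open>k2 \<le> k1\<close>, the bound \<open>V < \<pi>\<close> forces every zero of the defect between the two to have the
  same integer \<open>k1\<close>, so the codefect has the sign of \<open>cos (k1 \<pi>)\<close> at all of them. Then the
  defect, multiplied by this sign, crosses zero only upwards.\<close>

lemma eigenphase_strict_mono:
  fixes k1 k2 :: int
  assumes \<omega>: "0 \<le> \<omega>1" "\<omega>1 < \<omega>2" and zero: "defect bc (\<omega>1\<^sup>2) = 0" "defect bc (\<omega>2\<^sup>2) = 0"
    and k1: "\<bar>of_int k1 * pi - \<omega>1 * L\<bar> \<le> V / 2" and k2: "\<bar>of_int k2 * pi - \<omega>2 * L\<bar> \<le> V / 2"
  shows "k1 < k2"
proof (rule ccontr)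
  assume "\<not> k1 < k2"
  then have k21: "of_int k2 * pi \<le> of_int k1 * pi" by (intro mult_right_mono) auto
  let ?g = "\<lambda>\<mu>. defect bc \<mu> * cos (of_int k1 * pi)"
  show False
  proof (rule not_only_upcrossings[of "\<omega>1\<^sup>2" "\<omega>2\<^sup>2" ?g])
    fix \<nu> assume \<nu>: "\<nu> \<in> {\<omega>1\<^sup>2..\<omega>2\<^sup>2}" and "?g \<nu> = 0"
    then have D\<nu>: "defect bc \<nu> = 0" using int_multiple_pi(2)[of k1] by auto
    define \<omega> where "\<omega> = sqrt \<nu>"
    have "0 \<le> \<nu>" using \<nu> order.trans[OF zero_le_power2] by auto
    then have \<omega>\<nu>: "\<omega>\<^sup>2 = \<nu>" "\<omega> \<ge> 0" by (simp_all add: \<omega>_def)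
    have "\<omega>1 \<le> \<omega>" "\<omega> \<le> \<omega>2" using \<nu> \<omega>\<nu> \<omega> by (auto intro!: power2_le_imp_le[of \<omega>1 \<omega>] power2_le_imp_le[of \<omega> \<omega>2])
    then have L: "\<omega>1 * L \<le> \<omega> * L" "\<omega> * L \<le> \<omega>2 * L" using L_pos by auto
    obtain k :: int where k: "\<bar>of_int k * pi - \<omega> * L\<bar> \<le> V / 2" "0 < codefect bc (\<omega>\<^sup>2) * cos (of_int k * pi)"
      using eigenphase[of \<omega> bc] \<omega>\<nu> D\<nu> by auto
    have "k = k1" using k(1) k1 k2 L k21 V by (intro int_eq_if_near_pi) linarith
    with k(2) have pos: "0 < codefect bc \<nu> * cos (of_int k1 * pi)" by (simp add: \<omega>\<nu>)
    from defect_sign_near_zero[OF D\<nu>] show "\<forall>\<^sub>F \<mu> in at \<nu>. 0 < ?g \<mu> * (\<mu> - \<nu>)"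
    proof eventually_elim
      case (elim \<mu>)
      from elim pos have "0 < (defect bc \<mu> * codefect bc \<nu> * (\<mu> - \<nu>)) * (codefect bc \<nu> * cos (of_int k1 * pi))"
        by (rule mult_pos_pos)
      also have "\<dots> = (?g \<mu> * (\<mu> - \<nu>)) * (codefect bc \<nu>)\<^sup>2" by (simp add: power2_eq_square)
      finally show ?case by (simp add: zero_less_mult_iff)
    qed
  qed (use \<omega> zero in \<open>auto intro!: continuous_intros continuous_defect power_strict_mono\<close>)
qed

text \<open>At the frequencies with \<open>\<omega> L = k1 \<pi> + \<pi>/2\<close> and \<open>\<omega> L = k1 \<pi> + 3\<pi>/2\<close> the phase lies strictly within \<open>\<pi>/2\<close> of
  these values, so the defect has opposite signs there. Since the phases at the given zeros are
  off by at most \<open>V/2 < \<pi>/2\<close>, both frequencies lie between \<open>\<omega>1\<close> and \<open>\<omega>2\<close>.\<close>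

lemma eigenvalue_between:
  fixes k1 k2 :: int
  assumes \<omega>: "0 \<le> \<omega>1"
    and k1: "\<bar>of_int k1 * pi - \<omega>1 * L\<bar> \<le> V / 2" and k2: "\<bar>of_int k2 * pi - \<omega>2 * L\<bar> \<le> V / 2"
    and gap: "k1 + 1 < k2"
  obtains \<omega> where "\<omega>1 < \<omega>" "\<omega> < \<omega>2" "defect bc (\<omega>\<^sup>2) = 0"
proof -
  define a where "a = (of_int k1 * pi + pi / 2) / L"
  define b where "b = (of_int k1 * pi + 3 * pi / 2) / L"
  have aL: "a * L = of_int k1 * pi + pi / 2" and bL: "b * L = of_int k1 * pi + 3 * pi / 2"
    using L_pos by (simp_all add: a_def b_def)
  have "of_int (k1 + 2) * pi \<le> of_int k2 * pi" using gap by (intro mult_right_mono) (simp_all del: of_int_add)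
  then have k12: "of_int k1 * pi + 2 * pi \<le> of_int k2 * pi" by (simp add: distrib_right)
  have "\<omega>1 * L < a * L" "a * L < b * L" "b * L < \<omega>2 * L"
    unfolding aL bL using k1 k2 k12 V by linarith+
  then have ord: "\<omega>1 < a" "a < b" "b < \<omega>2" using L_pos by (simp_all add: mult_less_cancel_right)
  define g where "g \<omega> = defect bc (\<omega>\<^sup>2) * cos (of_int k1 * pi)" for \<omega>
  have e0: "(pi - V) / 4 > 0" using V by simp
  have e1: "V / 2 + (pi - V) / 4 < pi / 2" using V by (simp add: field_simps)
  have pos: "a > 0" "b > 0" using ord \<omega> by linarith+
  have mid: "0 < x" "x < pi" if "\<bar>x - pi / 2\<bar> < pi / 2" for x using that by linarith+
  have ga: "g a > 0"
  proof -
    obtain \<psi> P Q where P: "P > 0" "Q > 0" "defect bc (a\<^sup>2) = P * sin \<psi>" "codefect bc (a\<^sup>2) = Q * cos \<psi>"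
      and \<psi>: "\<bar>\<psi> - a * L\<bar> \<le> V / 2 + (pi - V) / 4"
      using phase_at_one[OF pos(1) e0, of bc] by metis
    have m: "\<bar>\<psi> - of_int k1 * pi - pi / 2\<bar> < pi / 2" using \<psi> e1 unfolding aL by linarith
    have "0 < sin (\<psi> - of_int k1 * pi)" using mid[OF m] by (rule sin_gt_zero)
    also have "\<dots> = sin \<psi> * cos (of_int k1 * pi)" by (simp add: sin_diff int_multiple_pi)
    finally show ?thesis using P(1) unfolding g_def P(3) by (simp add: mult.assoc)
  qed
  have gb: "g b < 0"
  proof -
    obtain \<psi> P Q where P: "P > 0" "Q > 0" "defect bc (b\<^sup>2) = P * sin \<psi>" "codefect bc (b\<^sup>2) = Q * cos \<psi>"
      and \<psi>: "\<bar>\<psi> - b * L\<bar> \<le> V / 2 + (pi - V) / 4"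
      using phase_at_one[OF pos(2) e0, of bc] by metis
    have m: "\<bar>\<psi> - of_int k1 * pi - pi - pi / 2\<bar> < pi / 2" using \<psi> e1 unfolding bL by linarith
    have "0 < sin (\<psi> - of_int k1 * pi - pi)" using mid[OF m] by (rule sin_gt_zero)
    also have "\<dots> = - (sin \<psi> * cos (of_int k1 * pi))" by (simp add: sin_diff int_multiple_pi)
    finally show ?thesis using P(1) unfolding g_def P(3) by (simp add: mult.assoc mult_less_0_iff)
  qed
  have "continuous_on {a..b} g"
    unfolding g_def by (intro continuous_intros continuous_on_compose2[OF continuous_defect]) auto
  then obtain \<omega> where "a \<le> \<omega>" "\<omega> \<le> b" "g \<omega> = 0"
    using IVT2'[of g b 0 a] ga gb ord by auto
  then show ?thesis using ord int_multiple_pi(2)[of k1] by (intro that[of \<omega>]) (auto simp: g_def)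
qed

end

section \<open>Gaps between eigenvalues\<close>

lemma LINT_eq_integral_spike:
  fixes f g :: "real \<Rightarrow> real"
  assumes f: "integrable (lebesgue_on {0..1}) f" and N: "negligible N"
    and eq: "\<And>x. x \<in> {0..1} - N \<Longrightarrow> f x = g x" and x: "x \<in> {0..1}"
  shows "(LINT s|lebesgue_on {0..x}. f s) = integral {0..x} g"
proof -
  have "integrable (lebesgue_on {0..x}) f"
    using f x by (intro integrable_subinterval[of 0 1 f 0 x]) auto
  then have "(LINT s|lebesgue_on {0..x}. f s) = integral {0..x} f"
    by (rule lebesgue_integral_eq_integral) auto
  also have "\<dots> = integral {0..x} g"
    using eq x by (intro integral_spike[OF N]) auto
  finally show ?thesis .
qed

context sl_speed
begin

text \<open>By constancy of Wronskians every solution satisfying the left boundary condition is a multiple of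
  the shooting solution.\<close>

lemma eigenvalue_imp_defect_zero:
  assumes eq: "\<And>x. x \<in> {0..1} - N \<Longrightarrow> s x = \<sigma> x"
    and ev: "eigenvalue bc \<sigma> (- (\<omega>\<^sup>2))"
  shows "defect bc (\<omega>\<^sup>2) = 0"
proof -
  from ev obtain \<omega>' v v' where "- (\<omega>\<^sup>2) = - (\<omega>'\<^sup>2)" and sol: "solution01 \<sigma> \<omega>' v v'"
    and bc: "satisfies_bc bc v v'" and nz: "\<exists>x\<in>{0..1}. v x \<noteq> 0"
    unfolding eigenvalue_def by blast
  then have "\<omega>'\<^sup>2 = \<omega>\<^sup>2" by simp
  with sol obtain v'' where der: "\<And>x. x \<in> {0..1} \<Longrightarrow> (v has_real_derivative v' x) (at x within {0..1})"
    and weak: "has_weak_deriv01 v' v''" and ae: "AE x in lebesgue_on {0..1}. v'' x + \<omega>\<^sup>2 * (\<sigma> x)\<^sup>2 * v x = 0"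
    by (auto simp: solution01_def)
  define M where "M = N \<union> {x \<in> {0..1}. \<not> (v'' x + \<omega>\<^sup>2 * (\<sigma> x)\<^sup>2 * v x = 0)}"
  have M: "negligible M" unfolding M_def by (intro negligible_Un N AE_lebesgue_on_negligible[OF ae]) auto
  have v'': "v'' x = - (\<omega>\<^sup>2) * (q x * v x)" if "x \<in> {0..1} - M" for x
    using that eq[of x] by (auto simp: M_def q_def)
  have "v' x = v' 0 - \<omega>\<^sup>2 * integral {0..x} (\<lambda>s. q s * v s)" if x: "x \<in> {0..1}" for x
  proof -
    have "v' x - v' 0 = (LINT s|lebesgue_on {0..x}. v'' s)" using weak x by (simp add: has_weak_deriv01_def)
    also have "\<dots> = integral {0..x} (\<lambda>s. - (\<omega>\<^sup>2) * (q s * v s))"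
      using weak by (intro LINT_eq_integral_spike[OF _ M v'' x]) (auto simp: has_weak_deriv01_def)
    finally show ?thesis by simp
  qed
  with der have sl: "sl_solution q (\<omega>\<^sup>2) v v'" unfolding sl_solution_def by blast
  let ?a = "bc_angle bc"
  define z where "z = shoot q (cos ?a) (- sin ?a) (\<omega>\<^sup>2)"
  define z' where "z' = shoot' q (cos ?a) (- sin ?a) (\<omega>\<^sup>2)"
  have z: "sl_solution q (\<omega>\<^sup>2) z z'" "z 0 = cos ?a" "z' 0 = - sin ?a"
    using shoot_solution[OF q_meas] by (simp_all add: z_def z'_def)
  define A where "A = v 0 * sin ?a + v' 0 * cos ?a"
  have sc: "sin ?a * sin ?a + cos ?a * cos ?a = 1"
    using sin_cos_squared_add[of ?a] unfolding power2_eq_square .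
  have bc0: "v 0 * cos ?a - v' 0 * sin ?a = 0" and bc1: "v 1 * cos ?a - v' 1 * sin ?a = 0"
    using bc by (cases bc; simp)+
  have multiple: "v x = A * left_bc_sol bc (\<omega>\<^sup>2) x \<and> v' x = A * left_bc_deriv bc (\<omega>\<^sup>2) x" if x: "x \<in> {0..1}" for x
  proof -
    have 1: "left_bc_sol bc (\<omega>\<^sup>2) x * z' x - left_bc_deriv bc (\<omega>\<^sup>2) x * z x = - 1"
      using lagrange_identity[OF q_meas left_bc_solution[of "\<omega>\<^sup>2" bc] z(1) x] sc by (simp add: z left_bc_at_0)
    have 2: "v x * z' x - v' x * z x = - A"
      using lagrange_identity[OF q_meas sl z(1) x] by (simp add: z A_def)
    have 3: "v x * left_bc_deriv bc (\<omega>\<^sup>2) x - v' x * left_bc_sol bc (\<omega>\<^sup>2) x = 0"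
      using lagrange_identity[OF q_meas sl left_bc_solution[of "\<omega>\<^sup>2" bc] x] bc0 by (simp add: left_bc_at_0)
    \<comment> \<open>Solve the three Wronskian relations for \<open>v\<close> and \<open>v'\<close>.\<close>
    show ?thesis using 1 2 3 by algebra
  qed
  then have "A \<noteq> 0" using nz by auto
  moreover have "A * defect bc (\<omega>\<^sup>2) = 0"
    using bc1 multiple[of 1] by (simp add: defect_def algebra_simps)
  ultimately show ?thesis by simp
qed

lemma defect_zero_imp_eigenvalue:
  assumes eq: "\<And>x. x \<in> {0..1} - N \<Longrightarrow> s x = \<sigma> x" and \<omega>: "0 \<le> \<omega>" and D: "defect bc (\<omega>\<^sup>2) = 0"
  shows "eigenvalue bc \<sigma> (- (\<omega>\<^sup>2))"
proof -
  let ?v = "left_bc_sol bc (\<omega>\<^sup>2)" and ?w = "left_bc_deriv bc (\<omega>\<^sup>2)"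
  let ?v'' = "\<lambda>x. - (\<omega>\<^sup>2) * (q x * ?v x)"
  have b: "bdd_meas01 ?v''"
    by (intro bdd_meas01_mult bdd_meas01_const q_meas bdd_meas01_continuous[OF continuous_left_bc_sol])
  have int: "integrable (lebesgue_on {0..1}) ?v''"
    by (rule absolutely_integrable_imp_integrable[OF bdd_meas01_absolutely_integrable[OF b]]) simp
  have "?w x - ?w 0 = (LINT s|lebesgue_on {0..x}. ?v'' s)" if x: "x \<in> {0..1}" for x
  proof -
    have "(LINT s|lebesgue_on {0..x}. ?v'' s) = integral {0..x} ?v''"
      by (rule LINT_eq_integral_spike[OF int negligible_empty _ x]) simp
    also have "\<dots> = - (\<omega>\<^sup>2) * integral {0..x} (\<lambda>s. q s * ?v s)" by (rule integral_mult_right)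
    finally show ?thesis using sl_solutionD(2)[OF left_bc_solution[of "\<omega>\<^sup>2" bc] x] by linarith
  qed
  with int have weak: "has_weak_deriv01 ?w ?v''" unfolding has_weak_deriv01_def by blast
  have "AE x in lebesgue_on {0..1}. ?v'' x + \<omega>\<^sup>2 * (\<sigma> x)\<^sup>2 * ?v x = 0"
    by (rule negligible_AE_lebesgue_on[OF N]) (auto simp: q_def eq)
  with weak have "solution01 \<sigma> \<omega> ?v ?w"
    unfolding solution01_def using sl_solutionD(1)[OF left_bc_solution[of "\<omega>\<^sup>2" bc]] by blast
  moreover have "satisfies_bc bc ?v ?w"
    using D by (cases bc) (auto simp: defect_def left_bc_at_0)
  moreover have "\<exists>x\<in>{0..1}. ?v x \<noteq> 0"
  proof (rule ccontr)
    assume "\<not> ?thesis"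
    then have "integral {0..1} (\<lambda>x. q x * ?v x * ?v x) = integral {0..1} (\<lambda>x::real. 0)"
      by (intro integral_cong) auto
    then show False using weighted_norm_pos[of bc "\<omega>\<^sup>2"] by simp
  qed
  ultimately show ?thesis using \<omega> unfolding eigenvalue_def by blast
qed

lemma eigenvalue_gap:
  assumes \<omega>: "0 \<le> \<omega>1" "\<omega>1 < \<omega>2" and zero: "defect bc (\<omega>1\<^sup>2) = 0" "defect bc (\<omega>2\<^sup>2) = 0"
  shows "(pi - V) / L \<le> \<omega>2 - \<omega>1"
    and "(\<And>\<omega>. \<lbrakk>\<omega>1 < \<omega>; \<omega> < \<omega>2\<rbrakk> \<Longrightarrow> defect bc (\<omega>\<^sup>2) \<noteq> 0) \<Longrightarrow> \<omega>2 - \<omega>1 \<le> (pi + V) / L"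
proof -
  obtain k1 :: int where k1: "\<bar>of_int k1 * pi - \<omega>1 * L\<bar> \<le> V / 2"
    using eigenphase[OF \<omega>(1) zero(1)] by blast
  have \<omega>2: "0 \<le> \<omega>2" using \<omega> by simp
  obtain k2 :: int where k2: "\<bar>of_int k2 * pi - \<omega>2 * L\<bar> \<le> V / 2"
    using eigenphase[OF \<omega>2 zero(2)] by blast
  have "k1 + 1 \<le> k2" using eigenphase_strict_mono[OF \<omega> zero k1 k2] by simp
  then have "of_int (k1 + 1) * pi \<le> of_int k2 * pi" by (intro mult_right_mono) (simp_all del: of_int_add)
  then have "of_int k1 * pi + pi \<le> of_int k2 * pi" by (simp add: distrib_right)
  then have "pi - V \<le> (\<omega>2 - \<omega>1) * L" unfolding left_diff_distrib using k1 k2 by linarith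
  then show "(pi - V) / L \<le> \<omega>2 - \<omega>1" using L_pos by (simp add: pos_divide_le_eq)
  show "\<omega>2 - \<omega>1 \<le> (pi + V) / L" if no: "\<And>\<omega>. \<lbrakk>\<omega>1 < \<omega>; \<omega> < \<omega>2\<rbrakk> \<Longrightarrow> defect bc (\<omega>\<^sup>2) \<noteq> 0"
  proof -
    have "\<not> k1 + 1 < k2"
    proof
      assume "k1 + 1 < k2"
      then obtain \<omega> where "\<omega>1 < \<omega>" "\<omega> < \<omega>2" "defect bc (\<omega>\<^sup>2) = 0"
        by (rule eigenvalue_between[OF \<omega>(1) k1 k2])
      with no show False by blast
    qed
    then have "of_int k2 * pi \<le> of_int (k1 + 1) * pi" by (intro mult_right_mono) (simp_all del: of_int_add)
    then have "of_int k2 * pi \<le> of_int k1 * pi + pi" by (simp add: distrib_right)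
    then have "(\<omega>2 - \<omega>1) * L \<le> pi + V" unfolding left_diff_distrib using k1 k2 by linarith
    then show ?thesis using L_pos by (simp add: pos_le_divide_eq)
  qed
qed

end

text \<open>The representative is \<open>exp (ln \<sigma>)\<close>, clamped to the admissible range. Going through \<open>ln \<sigma>\<close> makes it
  measurable, since only \<open>ln \<sigma>\<close> is known to be; it agrees with \<open>\<sigma>\<close> wherever the bounds hold.\<close>

lemma sl_speed_of_coefficient:
  fixes \<sigma> :: "real \<Rightarrow> real"
  assumes pos: "0 < \<sigma>min" and ae: "AE x in lebesgue_on {0..1}. \<sigma>min \<le> \<sigma> x \<and> \<sigma> x \<le> \<sigma>max"
    and bv: "(\<lambda>x. ln (\<sigma> x)) \<in> BV01" and var: "ess_variation (\<lambda>x. ln (\<sigma> x)) < ennreal pi"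
  obtains s smax N where "sl_speed s \<sigma>min smax (enn2real (ess_variation (\<lambda>x. ln (\<sigma> x)))) N"
    "\<And>x. x \<in> {0..1} - N \<Longrightarrow> s x = \<sigma> x"
proof -
  let ?f = "\<lambda>x. ln (\<sigma> x)"
  let ?V = "enn2real (ess_variation ?f)"
  define smax where "smax = max \<sigma>min \<sigma>max"
  define s where "s x = max \<sigma>min (min smax (exp (?f x)))" for x
  define N where "N = {x \<in> {0..1}. \<not> (\<sigma>min \<le> \<sigma> x \<and> \<sigma> x \<le> \<sigma>max)} \<union> {x \<in> {0..1}. \<not> approx_continuous01 ?f x}"
  have f: "?f \<in> borel_measurable (lebesgue_on {0..1})"
    using bv by (auto simp: BV01_def)
  have eq: "s x = \<sigma> x" if "x \<in> {0..1} - N" for x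
    using that pos by (auto simp: N_def s_def smax_def)
  have fin: "ess_variation ?f = ennreal ?V" using bv by (simp add: BV01_def)
  have "sl_speed s \<sigma>min smax ?V N"
  proof
    have bounds: "\<sigma>min \<le> s x \<and> s x \<le> smax" for x by (auto simp: s_def smax_def)
    then show "\<sigma>min \<le> s x \<and> s x \<le> smax" for x .
    have "s \<in> borel_measurable (lebesgue_on {0..1})"
      unfolding s_def[abs_def] using f by measurable
    then show "bdd_meas01 s"
    proof (rule bdd_meas01I)
      show "\<bar>s x\<bar> \<le> smax" for x using bounds[of x] pos by linarith
    qed
    show "0 < \<sigma>min" by (rule pos)
    show "negligible N"
      unfolding N_def by (intro negligible_Un AE_lebesgue_on_negligible[OF ae] AE_approx_continuous01 f) auto
    show "0 \<le> ?V" by simp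
    show "?V < pi" using var fin by (metis ennreal_less_iff enn2real_nonneg)
    show "(\<Sum>i<n. \<bar>ln (s (t i)) - ln (s (t (Suc i)))\<bar>) \<le> ?V"
      if t: "\<And>i. i \<le> n \<Longrightarrow> t i \<in> {0..1} - N" "\<And>i. i < n \<Longrightarrow> t i < t (Suc i)" for n t
    proof -
      have "partition01 ?f n t"
        unfolding partition01_def using t by (auto simp: N_def)
      then have "ennreal (\<Sum>i<n. \<bar>?f (t i) - ?f (t (Suc i))\<bar>) \<le> ess_variation ?f"
        unfolding ess_variation_def by (intro SUP_upper2[of "(n, t)"]) auto
      then have "(\<Sum>i<n. \<bar>?f (t i) - ?f (t (Suc i))\<bar>) \<le> ?V"
        by (subst (asm) fin) (simp add: ennreal_le_iff)
      moreover have "(\<Sum>i<n. \<bar>ln (s (t i)) - ln (s (t (Suc i)))\<bar>) = (\<Sum>i<n. \<bar>?f (t i) - ?f (t (Suc i))\<bar>)"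
        using t(1) by (intro sum.cong) (auto simp: eq)
      ultimately show ?thesis by simp
    qed
  qed
  with eq show ?thesis by (rule that[rotated])
qed

theorem theorem6:
  fixes \<sigma> :: "real \<Rightarrow> real" and \<sigma>min \<sigma>max lam1 lam2 \<omega>1 \<omega>2 :: real
    and bc :: boundary_condition
  assumes "0 < \<sigma>min"
    and "AE x in lebesgue_on {0..1}. \<sigma>min \<le> \<sigma> x \<and> \<sigma> x \<le> \<sigma>max"
    and "(\<lambda>x. ln (\<sigma> x)) \<in> BV01"
    and "ess_variation (\<lambda>x. ln (\<sigma> x)) < ennreal pi"
    and "eigenvalue bc \<sigma> lam1" and "eigenvalue bc \<sigma> lam2"
    and "\<omega>1 \<ge> 0" and "lam1 = - (\<omega>1\<^sup>2)"
    and "\<omega>2 \<ge> 0" and "lam2 = - (\<omega>2\<^sup>2)"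
    and "lam1 \<noteq> lam2"
  shows "(pi - enn2real (ess_variation (\<lambda>x. ln (\<sigma> x)))) / (LINT x|lebesgue_on {0..1}. \<sigma> x)
           \<le> \<bar>\<omega>1 - \<omega>2\<bar> \<and>
         ((\<forall>\<mu>. min lam1 lam2 < \<mu> \<and> \<mu> < max lam1 lam2 \<longrightarrow> \<not> eigenvalue bc \<sigma> \<mu>) \<longrightarrow>
         \<bar>\<omega>1 - \<omega>2\<bar>
           \<le> (pi + enn2real (ess_variation (\<lambda>x. ln (\<sigma> x)))) / (LINT x|lebesgue_on {0..1}. \<sigma> x))"
proof -
  define V where "V = enn2real (ess_variation (\<lambda>x. ln (\<sigma> x)))"
  obtain s smax N where "sl_speed s \<sigma>min smax V N" and eq: "\<And>x. x \<in> {0..1} - N \<Longrightarrow> s x = \<sigma> x"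
    unfolding V_def by (rule sl_speed_of_coefficient[OF assms(1-4)]) blast
  then interpret sl_speed s \<sigma>min smax V N by simp
  have "\<sigma> absolutely_integrable_on {0..1}"
    by (rule absolutely_integrable_spike[OF bdd_meas01_absolutely_integrable[OF s_meas] N]) (simp add: eq)
  then have "integrable (lebesgue_on {0..1}) \<sigma>"
    by (rule absolutely_integrable_imp_integrable) simp
  then have L: "(LINT x|lebesgue_on {0..1}. \<sigma> x) = L"
    unfolding L_def by (rule LINT_eq_integral_spike[OF _ N]) (simp_all add: eq)
  have main: "(pi - V) / L \<le> b - a \<and>
      ((\<forall>\<mu>. - (b\<^sup>2) < \<mu> \<and> \<mu> < - (a\<^sup>2) \<longrightarrow> \<not> eigenvalue bc \<sigma> \<mu>) \<longrightarrow> b - a \<le> (pi + V) / L)"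
    if ev: "eigenvalue bc \<sigma> (- (a\<^sup>2))" "eigenvalue bc \<sigma> (- (b\<^sup>2))" and ab: "0 \<le> a" "a < b" for a b
  proof -
    note gap = eigenvalue_gap[OF ab eigenvalue_imp_defect_zero[OF eq ev(1)] eigenvalue_imp_defect_zero[OF eq ev(2)]]
    show ?thesis
    proof (intro conjI impI)
      show "(pi - V) / L \<le> b - a" by (rule gap(1))
      assume no: "\<forall>\<mu>. - (b\<^sup>2) < \<mu> \<and> \<mu> < - (a\<^sup>2) \<longrightarrow> \<not> eigenvalue bc \<sigma> \<mu>"
      show "b - a \<le> (pi + V) / L"
      proof (rule gap(2))
        fix \<omega> assume \<omega>: "a < \<omega>" "\<omega> < b"
        then have "a\<^sup>2 < \<omega>\<^sup>2" "\<omega>\<^sup>2 < b\<^sup>2" using ab by (simp_all add: power_strict_mono)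
        then have "\<not> eigenvalue bc \<sigma> (- (\<omega>\<^sup>2))" using no by simp
        then show "defect bc (\<omega>\<^sup>2) \<noteq> 0" using defect_zero_imp_eigenvalue[OF eq, of \<omega>] \<omega> ab by auto
      qed
    qed
  qed
  have "\<omega>1 \<noteq> \<omega>2" using assms by auto
  then consider "\<omega>1 < \<omega>2" | "\<omega>2 < \<omega>1" by linarith
  then show ?thesis
    unfolding V_def[symmetric] L
  proof cases
    case 1
    then have "\<omega>1\<^sup>2 < \<omega>2\<^sup>2" using assms by (intro power_strict_mono) auto
    then show "(pi - V) / L \<le> \<bar>\<omega>1 - \<omega>2\<bar> \<and>
      ((\<forall>\<mu>. min lam1 lam2 < \<mu> \<and> \<mu> < max lam1 lam2 \<longrightarrow> \<not> eigenvalue bc \<sigma> \<mu>) \<longrightarrow> \<bar>\<omega>1 - \<omega>2\<bar> \<le> (pi + V) / L)"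
      using main[of \<omega>1 \<omega>2] 1 assms by (simp add: min_def max_def)
  next
    case 2
    then have "\<omega>2\<^sup>2 < \<omega>1\<^sup>2" using assms by (intro power_strict_mono) auto
    then show "(pi - V) / L \<le> \<bar>\<omega>1 - \<omega>2\<bar> \<and>
      ((\<forall>\<mu>. min lam1 lam2 < \<mu> \<and> \<mu> < max lam1 lam2 \<longrightarrow> \<not> eigenvalue bc \<sigma> \<mu>) \<longrightarrow> \<bar>\<omega>1 - \<omega>2\<bar> \<le> (pi + V) / L)"
      using main[of \<omega>2 \<omega>1] 2 assms by (simp add: min_def max_def)
  qed
qed

end
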